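(* Let $M \ge 1$ be an integer, $\varepsilon \in (0,1)$, and suppose we are given $X = \{x_1,\ldots,x_n\} \subseteq \{0,1,\ldots,M\}^d$, which implicitly defines the $n\times n$ matrix $A$ with $A_{i,j} = \|x_i - x_j\|_\infty$. Then there is an $n \times n$ matrix $B$ with $\|A - B\|_\infty \le \varepsilon$ such that for any query $y \in \mathbb{R}^n$, one can compute $By$ in time $n \cdot (dM)^{O(M \sqrt{d} \log(Md/\varepsilon))}$.
   Context: For matrices, $\|A - B\|_\infty = \max_{i,j} |A_{i,j} - B_{i,j}|$ (entrywise maximum). For vectors, $\|v\|_\infty = \max_i |v_i|$. *)

theory Defs
  imports Complex_Main "Jordan_Normal_Form.Matrix"
begin

section \<open>Norms and the distance matrix\<close>

text \<open>Both maxima are only meant for nonempty vectors and matrices.\<close>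

definition vec_max_norm :: "real vec \<Rightarrow> real" where
  "vec_max_norm v = Max {\<bar>v $ i\<bar> | i. i < dim_vec v}"

definition mat_max_norm :: "real mat \<Rightarrow> real" where
  "mat_max_norm A = Max {\<bar>A $$ (i, j)\<bar> | i j. i < dim_row A \<and> j < dim_col A}"

definition grid :: "nat \<Rightarrow> nat \<Rightarrow> nat vec set" where
  "grid M d = {x \<in> carrier_vec d. \<forall>k<d. x $ k \<le> M}"

text \<open>Coordinates are made real before subtracting, since subtraction on \<^typ>\<open>nat\<close> truncates.\<close>

definition linf_dist_matrix :: "nat vec list \<Rightarrow> real mat" where
  "linf_dist_matrix xs = mat (length xs) (length xs)
     (\<lambda>(i, j). vec_max_norm (map_vec real (xs ! i) - map_vec real (xs ! j)))"


section \<open>A real random access machine\<close>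

text \<open>
  The memory consists of infinite arrays of natural numbers and infinite arrays of real numbers,
  addressed by an array name and an index. A program mentions only finitely many names, so this is
  the usual real RAM with indirect addressing up to a constant factor. Scalars are cells at index 0.

  The model is deliberately weak: natural numbers (the only possible addresses) can merely be added,
  subtracted (truncating at 0) and compared, reals support exact field arithmetic and comparison,
  the only real constants in programs are natural numbers, and there is no rounding from reals
  to naturals.
\<close>

type_synonym name = string

record store =
  nats :: "name \<Rightarrow> nat \<Rightarrow> nat"
  reals :: "name \<Rightarrow> nat \<Rightarrow> real"

datatype nexp =
    NConst nat
  | NGet name nexp
  | NAdd nexp nexp
  | NSub nexp nexp

datatype rexp =
    ROfNat nexp
  | RGet name nexp
  | RAdd rexp rexp
  | RSub rexp rexp
  | RMul rexp rexp
  | RDiv rexp rexp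

datatype bexp =
    NLess nexp nexp
  | RLess rexp rexp
  | BNot bexp
  | BAnd bexp bexp

datatype com =
    Skip
  | NSet name nexp nexp
  | RSet name nexp rexp
  | Seq com com
  | If bexp com com
  | While bexp com

primrec nval :: "nexp \<Rightarrow> store \<Rightarrow> nat" where
  "nval (NConst c) s = c"
| "nval (NGet a e) s = nats s a (nval e s)"
| "nval (NAdd e f) s = nval e s + nval f s"
| "nval (NSub e f) s = nval e s - nval f s"

primrec rval :: "rexp \<Rightarrow> store \<Rightarrow> real" where
  "rval (ROfNat e) s = real (nval e s)"
| "rval (RGet a e) s = reals s a (nval e s)"
| "rval (RAdd e f) s = rval e s + rval f s"
| "rval (RSub e f) s = rval e s - rval f s"
| "rval (RMul e f) s = rval e s * rval f s"
| "rval (RDiv e f) s = rval e s / rval f s"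

primrec bval :: "bexp \<Rightarrow> store \<Rightarrow> bool" where
  "bval (NLess e f) s = (nval e s < nval f s)"
| "bval (RLess e f) s = (rval e s < rval f s)"
| "bval (BNot b) s = (\<not> bval b s)"
| "bval (BAnd b c) s = (bval b s \<and> bval c s)"

text \<open>
  Unit cost: every constant, memory access, conversion, arithmetic operation, comparison and
  logical connective costs 1, and so does every assignment and every branching decision.
\<close>

primrec ncost :: "nexp \<Rightarrow> nat" where
  "ncost (NConst c) = 1"
| "ncost (NGet a e) = 1 + ncost e"
| "ncost (NAdd e f) = 1 + ncost e + ncost f"
| "ncost (NSub e f) = 1 + ncost e + ncost f"

primrec rcost :: "rexp \<Rightarrow> nat" where
  "rcost (ROfNat e) = 1 + ncost e"
| "rcost (RGet a e) = 1 + ncost e"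
| "rcost (RAdd e f) = 1 + rcost e + rcost f"
| "rcost (RSub e f) = 1 + rcost e + rcost f"
| "rcost (RMul e f) = 1 + rcost e + rcost f"
| "rcost (RDiv e f) = 1 + rcost e + rcost f"

primrec bcost :: "bexp \<Rightarrow> nat" where
  "bcost (NLess e f) = 1 + ncost e + ncost f"
| "bcost (RLess e f) = 1 + rcost e + rcost f"
| "bcost (BNot b) = 1 + bcost b"
| "bcost (BAnd b c) = 1 + bcost b + bcost c"

definition nupd :: "name \<Rightarrow> nat \<Rightarrow> nat \<Rightarrow> store \<Rightarrow> store" where
  "nupd a i v s = s\<lparr>nats := (nats s)(a := (nats s a)(i := v))\<rparr>"

definition rupd :: "name \<Rightarrow> nat \<Rightarrow> real \<Rightarrow> store \<Rightarrow> store" where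
  "rupd a i v s = s\<lparr>reals := (reals s)(a := (reals s a)(i := v))\<rparr>"

text \<open>\<open>exec c s t s'\<close>: started in \<open>s\<close>, program \<open>c\<close> halts in \<open>s'\<close> after exactly \<open>t\<close> steps.\<close>

inductive exec :: "com \<Rightarrow> store \<Rightarrow> nat \<Rightarrow> store \<Rightarrow> bool" where
  Skip: "exec Skip s 1 s"
| NSet: "exec (NSet a e f) s (1 + ncost e + ncost f) (nupd a (nval e s) (nval f s) s)"
| RSet: "exec (RSet a e f) s (1 + ncost e + rcost f) (rupd a (nval e s) (rval f s) s)"
| Seq: "exec c s t s' \<Longrightarrow> exec c' s' t' s'' \<Longrightarrow> exec (Seq c c') s (t + t') s''"
| IfTrue: "bval b s \<Longrightarrow> exec c s t s' \<Longrightarrow> exec (If b c c') s (1 + bcost b + t) s'"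
| IfFalse: "\<not> bval b s \<Longrightarrow> exec c' s t s' \<Longrightarrow> exec (If b c c') s (1 + bcost b + t) s'"
| WhileFalse: "\<not> bval b s \<Longrightarrow> exec (While b c) s (1 + bcost b) s"
| WhileTrue: "bval b s \<Longrightarrow> exec c s t s' \<Longrightarrow> exec (While b c) s' t' s'' \<Longrightarrow>
    exec (While b c) s (1 + bcost b + t + t') s''"

inductive_cases SkipE: "exec Skip s t s'"
inductive_cases NSetE: "exec (NSet a e f) s t s'"
inductive_cases RSetE: "exec (RSet a e f) s t s'"
inductive_cases SeqE: "exec (Seq c c') s t s'"
inductive_cases IfE: "exec (If b c c') s t s'"
inductive_cases WhileE: "exec (While b c) s t s'"

lemma exec_deterministic:
  "exec c s t s' \<Longrightarrow> exec c s u s'' \<Longrightarrow> t = u \<and> s' = s''"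
proof (induction arbitrary: u s'' rule: exec.induct)
  case (Skip s)
  then show ?case by (rule SkipE) simp
next
  case (NSet a e f s)
  then show ?case by (rule NSetE) simp
next
  case (RSet a e f s)
  then show ?case by (rule RSetE) simp
next
  case (Seq c s t s' c' t' r)
  from Seq.prems show ?case
    by (rule SeqE) (metis Seq.IH)
next
  case (IfTrue b s c t s' c')
  from IfTrue.prems show ?case
    by (rule IfE) (use IfTrue.hyps(1) IfTrue.IH in \<open>simp, metis?\<close>)+
next
  case (IfFalse b s c' t s' c)
  from IfFalse.prems show ?case
    by (rule IfE) (use IfFalse.hyps(1) IfFalse.IH in \<open>simp, metis?\<close>)+
next
  case (WhileFalse b s c)
  from WhileFalse.prems show ?case
    by (rule WhileE) (use WhileFalse.hyps in simp)+
next
  case (WhileTrue b s c t s' t' r)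
  from WhileTrue.prems show ?case
    by (rule WhileE) (use WhileTrue.hyps(1) WhileTrue.IH in \<open>simp, metis?\<close>)+
qed


section \<open>Matrix-vector queries\<close>

text \<open>
  The input consists of the parameters, the points (coordinate \<open>k\<close> of point \<open>i\<close> is in cell
  \<open>i * d + k\<close>) and the query vector; all other cells are 0. In particular neither the distance
  matrix nor any preprocessed data is part of the input.
\<close>

definition query_input :: "nat \<Rightarrow> nat \<Rightarrow> real \<Rightarrow> nat vec list \<Rightarrow> real vec \<Rightarrow> store" where
  "query_input M d \<epsilon> xs y =
    \<lparr>nats = (\<lambda>_ _. 0)
       (''n'' := (\<lambda>_. 0)(0 := length xs),
        ''d'' := (\<lambda>_. 0)(0 := d),
        ''M'' := (\<lambda>_. 0)(0 := M),
        ''x'' := (\<lambda>p. if p < length xs * d then (xs ! (p div d)) $ (p mod d) else 0)),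
     reals = (\<lambda>_ _. 0)
       (''eps'' := (\<lambda>_. 0)(0 := \<epsilon>),
        ''y'' := (\<lambda>i. if i < dim_vec y then y $ i else 0))\<rparr>"

definition outputs_in_time :: "com \<Rightarrow> store \<Rightarrow> real vec \<Rightarrow> real \<Rightarrow> bool" where
  "outputs_in_time c s v T \<longleftrightarrow>
    (\<exists>t s'. exec c s t s' \<and> real t \<le> T \<and> (\<forall>i<dim_vec v. reals s' ''out'' i = v $ i))"

end

theory Submission
  imports Defs
begin

text \<open>
  Write the distance of two points as the sum over \<open>t < M\<close> of the indicators that the number \<open>c\<close>
  of coordinates differing by more than \<open>t\<close> is nonzero. Let \<open>T\<close> be the Chebyshev polynomial of
  degree \<open>2 ^ k\<close> and \<open>\<zeta> = 1 + 1 / d\<close>. Then \<open>1 - T (\<zeta> - c / d) / T \<zeta>\<close> vanishes at \<open>c = 0\<close> and is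
  within \<open>1 / T \<zeta>\<close> of 1 for \<open>1 \<le> c \<le> d\<close>, and \<open>2 * T \<zeta> \<ge> exp (2 ^ k / sqrt d)\<close>, so that some
  \<open>2 ^ k\<close> of order \<open>sqrt d * ln (M / \<epsilon>)\<close> makes the total error at most \<open>\<epsilon>\<close>.

  The count \<open>c\<close> is an inner product of 0/1 vectors indexed by pairs (coordinate, value), and the
  recurrence \<open>z \<mapsto> 2 * z\<^sup>2 - 1\<close> turns an inner product of vectors into one of their tensor squares
  (with one extra entry). Hence \<open>T (\<zeta> - c / d)\<close> is an inner product of vectors of length at most
  \<open>(d * (M + 1) + 2) ^ 2 ^ k\<close>, and the approximating matrix factors accordingly. The machine needs
  neither \<open>ln\<close> nor \<open>sqrt\<close>: it runs the recurrence from \<open>\<zeta>\<close> until the value reaches \<open>M / \<epsilon>\<close>.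

  For \<open>d = 1\<close> the choice \<open>\<zeta> = 1\<close>, \<open>k = 0\<close> is exact; this is needed because the time bound does not
  depend on \<open>\<epsilon>\<close> when \<open>d = M = 1\<close>.
\<close>

section \<open>Reasoning about running times\<close>

text \<open>Upper bounds replace the exact step counts of \<open>exec\<close>, so that they can be
  rounded up at each composition. Halting is part of the claim.\<close>

definition runs_within :: "com \<Rightarrow> store \<Rightarrow> nat \<Rightarrow> (store \<Rightarrow> bool) \<Rightarrow> bool" where
  "runs_within c s T Q \<longleftrightarrow> (\<exists>t s'. exec c s t s' \<and> t \<le> T \<and> Q s')"

lemma runs_within_mono:
  "runs_within c s T Q \<Longrightarrow> T \<le> T' \<Longrightarrow> (\<And>s'. Q s' \<Longrightarrow> Q' s') \<Longrightarrow> runs_within c s T' Q'"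
  unfolding runs_within_def by (meson order_trans)

lemma nats_nupd [simp]: "nats (nupd a i v s) = (nats s)(a := (nats s a)(i := v))"
  and reals_nupd [simp]: "reals (nupd a i v s) = reals s"
  by (simp_all add: nupd_def)

lemma nats_rupd [simp]: "nats (rupd a i v s) = nats s"
  and reals_rupd [simp]: "reals (rupd a i v s) = (reals s)(a := (reals s a)(i := v))"
  by (simp_all add: rupd_def)

lemma runs_within_NSet:
  "Q (nupd a (nval e s) (nval f s) s) \<Longrightarrow> 1 + ncost e + ncost f \<le> T \<Longrightarrow> runs_within (NSet a e f) s T Q"
  unfolding runs_within_def using exec.NSet by blast

lemma runs_within_RSet:
  "Q (rupd a (nval e s) (rval f s) s) \<Longrightarrow> 1 + ncost e + rcost f \<le> T \<Longrightarrow> runs_within (RSet a e f) s T Q"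
  unfolding runs_within_def using exec.RSet by blast

lemma runs_within_Seq:
  assumes "runs_within c s T1 Q1" "\<And>s'. Q1 s' \<Longrightarrow> runs_within c' s' T2 Q" "T1 + T2 \<le> T"
  shows "runs_within (Seq c c') s T Q"
proof -
  obtain t s' where 1: "exec c s t s'" "t \<le> T1" "Q1 s'"
    using assms(1) by (auto simp: runs_within_def)
  obtain t' s'' where 2: "exec c' s' t' s''" "t' \<le> T2" "Q s''"
    using assms(2)[OF 1(3)] by (auto simp: runs_within_def)
  have "t + t' \<le> T"
    using 1(2) 2(2) assms(3) by linarith
  then show ?thesis
    unfolding runs_within_def using exec.Seq[OF 1(1) 2(1)] 2(3) by blast
qed

lemma runs_within_NSet_Seq:
  assumes "runs_within c (nupd a (nval e s) (nval f s) s) T' Q" "1 + ncost e + ncost f + T' \<le> T"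
  shows "runs_within (Seq (NSet a e f) c) s T Q"
  by (rule runs_within_Seq[where ?Q1.0 = "\<lambda>s'. s' = nupd a (nval e s) (nval f s) s", OF runs_within_NSet])
    (use assms in auto)

lemma runs_within_RSet_Seq:
  assumes "runs_within c (rupd a (nval e s) (rval f s) s) T' Q" "1 + ncost e + rcost f + T' \<le> T"
  shows "runs_within (Seq (RSet a e f) c) s T Q"
  by (rule runs_within_Seq[where ?Q1.0 = "\<lambda>s'. s' = rupd a (nval e s) (rval f s) s", OF runs_within_RSet])
    (use assms in auto)

text \<open>The invariant is indexed by the number of rounds made, so it yields termination after
  exactly \<open>N\<close> rounds together with correctness.\<close>

lemma runs_within_While:
  assumes "I 0 s"
    and step: "\<And>k s. k < N \<Longrightarrow> I k s \<Longrightarrow> bval b s \<and> runs_within c s T (I (Suc k))"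
    and stop: "\<And>s. I N s \<Longrightarrow> \<not> bval b s"
  shows "runs_within (While b c) s (N * (1 + bcost b + T) + (1 + bcost b)) (I N)"
proof -
  \<comment> \<open>Induction on the number \<open>k\<close> of rounds still to be made.\<close>
  have "I (N - k) s \<Longrightarrow> k \<le> N \<Longrightarrow>
    runs_within (While b c) s (k * (1 + bcost b + T) + (1 + bcost b)) (I N)" for k s
  proof (induction k arbitrary: s)
    case 0
    then show ?case
      unfolding runs_within_def using exec.WhileFalse[OF stop] by force
  next
    case (Suc k)
    have b: "bval b s" and "runs_within c s T (I (Suc (N - Suc k)))"
      using step[of "N - Suc k" s] Suc.prems by auto
    then obtain t s' where 1: "exec c s t s'" "t \<le> T" "I (N - k) s'"
      using Suc.prems by (auto simp: runs_within_def Suc_diff_Suc)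
    obtain t' s'' where 2: "exec (While b c) s' t' s''"
      "t' \<le> k * (1 + bcost b + T) + (1 + bcost b)" "I N s''"
      using Suc.IH[OF 1(3)] Suc.prems by (auto simp: runs_within_def)
    have "1 + bcost b + t + t' \<le> Suc k * (1 + bcost b + T) + (1 + bcost b)"
      using 1(2) 2(2) by simp
    then show ?case
      unfolding runs_within_def using exec.WhileTrue[OF b 1(1) 2(1)] 2(3) by blast
  qed
  from this[of N s] show ?thesis
    using assms(1) by simp
qed

abbreviation V :: "name \<Rightarrow> nexp" where "V v \<equiv> NGet v (NConst 0)"
abbreviation W :: "name \<Rightarrow> rexp" where "W v \<equiv> RGet v (NConst 0)"

definition For :: "name \<Rightarrow> nexp \<Rightarrow> com \<Rightarrow> com" where
  "For v e c = Seq (NSet v (NConst 0) (NConst 0))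
     (While (NLess (V v) e) (Seq c (NSet v (NConst 0) (NAdd (V v) (NConst 1)))))"

text \<open>\<open>For\<close> evaluates its bound anew at each test, hence the invariant has to fix
  the value of \<open>e\<close>. Besides the body, a round costs 6 for the increment and
  \<open>4 + ncost e\<close> for the test; the initialization costs 3.\<close>

lemma runs_within_For:
  assumes bound: "\<And>k s. I k s \<Longrightarrow> nval e s = N"
    and init: "I 0 (nupd v 0 0 s)"
    and step: "\<And>k s. k < N \<Longrightarrow> I k s \<Longrightarrow> nats s v 0 = k \<Longrightarrow>
      runs_within c s T (\<lambda>s'. nats s' v 0 = k \<and> I (Suc k) (nupd v 0 (Suc k) s'))"
    and T': "N * (T + ncost e + 10) + ncost e + 7 \<le> T'"
  shows "runs_within (For v e c) s T' (I N)"
proof -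
  have run: "runs_within (While (NLess (V v) e) (Seq c (NSet v (NConst 0) (NAdd (V v) (NConst 1)))))
      (nupd v 0 0 s) (N * (1 + bcost (NLess (V v) e) + (T + 6)) + (1 + bcost (NLess (V v) e)))
      (\<lambda>s'. I N s' \<and> nats s' v 0 = N)"
  proof (rule runs_within_While[where I = "\<lambda>k s. I k s \<and> nats s v 0 = k"])
    fix k s assume k: "k < N" and s: "I k s \<and> nats s v 0 = k"
    have "runs_within (Seq c (NSet v (NConst 0) (NAdd (V v) (NConst 1)))) s (T + 6)
      (\<lambda>s. I (Suc k) s \<and> nats s v 0 = Suc k)"
      by (rule runs_within_Seq[OF step[OF k]]) (use s in \<open>auto intro!: runs_within_NSet\<close>)
    then show "bval (NLess (V v) e) s \<and> runs_within (Seq c (NSet v (NConst 0) (NAdd (V v) (NConst 1)))) s (T + 6)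
      (\<lambda>s. I (Suc k) s \<and> nats s v 0 = Suc k)"
      using s k bound by auto
  qed (use init bound in auto)
  show ?thesis
    unfolding For_def
  proof (rule runs_within_NSet_Seq[where T' = "N * (T + ncost e + 10) + ncost e + 4"])
    show "runs_within (While (NLess (V v) e) (Seq c (NSet v (NConst 0) (NAdd (V v) (NConst 1)))))
        (nupd v (nval (NConst 0) s) (nval (NConst 0) s) s) (N * (T + ncost e + 10) + ncost e + 4) (I N)"
      unfolding nval.simps by (rule runs_within_mono[OF run]) (simp_all add: algebra_simps)
  qed (use T' in simp)
qed

text \<open>A frame condition: the two sets name the natural and the real arrays that a program may
  write, so facts about all other arrays survive.\<close>

definition agree_off :: "name set \<Rightarrow> name set \<Rightarrow> store \<Rightarrow> store \<Rightarrow> bool" where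
  "agree_off A B s s' \<longleftrightarrow> (\<forall>v. v \<notin> A \<longrightarrow> nats s' v = nats s v) \<and> (\<forall>v. v \<notin> B \<longrightarrow> reals s' v = reals s v)"

lemma agree_off_trans:
  "agree_off A B s s' \<Longrightarrow> agree_off A' B' s' s'' \<Longrightarrow> A \<subseteq> A'' \<Longrightarrow> A' \<subseteq> A'' \<Longrightarrow> B \<subseteq> B'' \<Longrightarrow> B' \<subseteq> B'' \<Longrightarrow>
    agree_off A'' B'' s s''"
  unfolding agree_off_def by (metis subset_iff)

section \<open>Chebyshev polynomials of degree a power of two\<close>

text \<open>\<open>cheb z k\<close> is the Chebyshev polynomial of degree \<open>2 ^ k\<close> at \<open>z\<close>.\<close>

fun cheb :: "real \<Rightarrow> nat \<Rightarrow> real" where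
  "cheb z 0 = z"
| "cheb z (Suc k) = 2 * cheb z k * cheb z k - 1"

lemma abs_cheb_le_1: "\<bar>z\<bar> \<le> 1 \<Longrightarrow> \<bar>cheb z k\<bar> \<le> 1"
proof (induction k)
  case (Suc k)
  then have "cheb z k * cheb z k \<le> 1"
    using abs_square_le_1[of "cheb z k"] by (simp add: power2_eq_square)
  moreover have "0 \<le> cheb z k * cheb z k" by simp
  ultimately show ?case by (simp add: abs_le_iff)
qed simp

lemma cheb_1 [simp]: "cheb 1 k = 1"
  by (induction k) auto

lemma cheb_mono:
  assumes "1 \<le> z" "z \<le> w"
  shows "1 \<le> cheb z k \<and> cheb z k \<le> cheb w k"
proof (induction k)
  case (Suc k)
  then have "cheb z k * cheb z k \<le> cheb w k * cheb w k" "1 * 1 \<le> cheb z k * cheb z k"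
    by (intro mult_mono; simp)+
  then show ?case by simp
qed (use assms in simp)

text \<open>The recurrence is the doubling formula of cosh. This gives access to the growth of
  \<open>cheb\<close> to the right of 1.\<close>

lemma cheb_cosh: "cheb (cosh u) k = cosh (2 ^ k * u)"
proof (induction k)
  case (Suc k)
  have "cosh (2 ^ Suc k * u) = cosh (2 * (2 ^ k * u))"
    by (simp add: mult_ac)
  also have "\<dots> = 2 * cosh (2 ^ k * u) ^ 2 - 1"
    using cosh_square_eq[of "2 ^ k * u"] by (simp only: cosh_double) simp
  finally show ?case
    using Suc by (simp add: power2_eq_square)
qed simp

text \<open>Needed at \<open>u = 1 / sqrt d\<close>, to place \<open>1 + 1 / d\<close> to the right
  of a point of the form \<open>cosh u\<close>.\<close>

lemma cosh_le_1_plus_square: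
  assumes "0 \<le> u" "u \<le> (1::real)"
  shows "cosh u \<le> 1 + u\<^sup>2"
proof -
  have "exp u \<le> 1 + u + u\<^sup>2"
    by (rule exp_bound) (use assms in auto)
  moreover have "exp (- u) \<le> 1 - u + u\<^sup>2"
  proof -
    \<comment> \<open>The product equals \<open>1 + u ^ 3\<close>.\<close>
    have "1 \<le> (1 + u) * (1 - u + u\<^sup>2)"
      using assms by (simp add: algebra_simps power2_eq_square)
    also have "\<dots> \<le> exp u * (1 - u + u\<^sup>2)"
      by (rule mult_right_mono[OF exp_ge_add_one_self]) (use assms in simp)
    finally show ?thesis
      by (simp add: exp_minus divide_simps mult.commute)
  qed
  ultimately show ?thesis
    by (simp add: cosh_field_def)
qed

text \<open>For \<open>u = 1 / sqrt d\<close> the argument is at least \<open>cosh u\<close>.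
  Monotonicity then leaves \<open>cosh (2 ^ k * u)\<close>, which is at least half of
  \<open>exp (2 ^ k * u)\<close>.\<close>

lemma cheb_ge_exp:
  assumes "1 \<le> d"
  shows "exp (2 ^ k / sqrt (real d)) \<le> 2 * cheb (1 + 1 / real d) k"
proof -
  define u where "u = 1 / sqrt (real d)"
  have u: "0 \<le> u" "u \<le> 1" "u\<^sup>2 = 1 / real d"
    using assms by (auto simp: u_def power_divide)
  have "exp (2 ^ k * u) \<le> 2 * cosh (2 ^ k * u)"
    by (simp add: cosh_field_def)
  also have "cosh (2 ^ k * u) \<le> cheb (1 + 1 / real d) k"
    using cheb_mono[of "cosh u" "1 + u\<^sup>2"] cosh_le_1_plus_square[OF u(1,2)] cosh_real_ge_1[of u]
    by (simp add: cheb_cosh u(3))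
  finally show ?thesis
    by (simp add: u_def)
qed

text \<open>The last hypothesis is the loop test of \<open>Build\<close> for
  \<open>d \<ge> 2\<close>: while the loop continues, the degree stays below the desired
  order.\<close>

lemma power_less_of_cheb_less:
  assumes "1 \<le> d" "0 < \<epsilon>" "cheb (1 + 1 / real d) k * \<epsilon> < real M"
  shows "2 ^ k < sqrt (real d) * ln (2 * real M / \<epsilon>)"
proof -
  have "exp (2 ^ k / sqrt (real d)) * \<epsilon> \<le> 2 * cheb (1 + 1 / real d) k * \<epsilon>"
    using cheb_ge_exp[OF assms(1), of k] assms(2) by (intro mult_right_mono) auto
  with assms(3) have "exp (2 ^ k / sqrt (real d)) * \<epsilon> < 2 * real M"
    by linarith
  then have *: "exp (2 ^ k / sqrt (real d)) < 2 * real M / \<epsilon>"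
    using assms(2) by (simp add: pos_less_divide_eq)
  then have "2 ^ k / sqrt (real d) < ln (2 * real M / \<epsilon>)"
    using less_trans[OF exp_gt_zero *] by (metis exp_less_cancel_iff exp_ln)
  then show ?thesis
    using assms(1) by (simp add: field_simps)
qed

text \<open>This makes the loop of \<open>Build\<close> terminate. The truncated
  \<open>1 - (2 - d)\<close> is 0 for \<open>d = 1\<close>, where the test fails at once, and 1
  otherwise, where some degree exceeds the bound of \<open>power_less_of_cheb_less\<close>.\<close>

lemma cheb_stops:
  assumes "0 < \<epsilon>" "1 \<le> d" and \<zeta>: "\<zeta> = 1 + real (1 - (2 - d)) / real d"
  shows "\<exists>k. \<not> cheb \<zeta> k * \<epsilon> < real M * real (1 - (2 - d))"
proof (cases "d = 1")
  case True
  then show ?thesis using assms by (intro exI[of _ 0]) simp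
next
  case False
  then have d: "1 - (2 - d) = 1" using assms(2) by simp
  obtain k where k: "sqrt (real d) * ln (2 * real M / \<epsilon>) < 2 ^ k"
    using real_arch_pow[of 2] by auto
  then have "\<not> cheb (1 + 1 / real d) k * \<epsilon> < real M"
    using power_less_of_cheb_less[OF assms(2,1), of k M] by auto
  then have "\<not> cheb \<zeta> k * \<epsilon> < real M * real (1 - (2 - d))"
    by (simp only: \<zeta> d of_nat_1 mult_1_right not_False_eq_True)
  then show ?thesis ..
qed

section \<open>Feature vectors\<close>

fun fsize :: "nat \<Rightarrow> nat \<Rightarrow> nat" where
  "fsize N 0 = N + 1"
| "fsize N (Suc k) = fsize N k * fsize N k + 1"

text \<open>One recursion serves both factors of the inner product: \<open>\<alpha>\<close>,
  \<open>c\<close>, \<open>e\<close> are 1, 1, 1 for rows and \<open>\<zeta>\<close>, 2, -1 for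
  columns. Quotient and remainder decode the index pair of a tensor square; the last entry is the
  additional constant.\<close>

fun feat :: "real \<Rightarrow> real \<Rightarrow> real \<Rightarrow> nat \<Rightarrow> (nat \<Rightarrow> real) \<Rightarrow> nat \<Rightarrow> nat \<Rightarrow> real" where
  "feat \<alpha> c e N u 0 r = (if r < N then u r else \<alpha>)"
| "feat \<alpha> c e N u (Suc k) r =
    (if r < fsize N k * fsize N k
     then c * (feat \<alpha> c e N u k (r div fsize N k) * feat \<alpha> c e N u k (r mod fsize N k)) else e)"

lemma fsize_pos: "1 \<le> fsize N k"
  by (cases k) auto

lemma fsize_mono: "k \<le> l \<Longrightarrow> fsize N k \<le> fsize N l"
proof (rule lift_Suc_mono_le[where f = "fsize N"])
  show "fsize N k \<le> fsize N (Suc k)" for k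
    using fsize_pos[of N k] by (simp add: le_SucI)
qed

text \<open>Lets the number of squaring rounds be bounded by the length of the final vector.\<close>

lemma less_fsize: "1 \<le> N \<Longrightarrow> k + 1 < fsize N k"
proof (induction k)
  case (Suc k)
  then have IH: "k + 1 < fsize N k"
    by simp
  then have "2 * fsize N k \<le> fsize N k * fsize N k"
    by (intro mult_right_mono) auto
  with IH show ?case
    unfolding fsize.simps by linarith
qed auto

text \<open>The summand 1 on the left makes the induction close, as
  \<open>R * R + 2 \<le> (R + 1) ^ 2\<close> for \<open>R \<ge> 1\<close>.\<close>

lemma fsize_le: "fsize N k + 1 \<le> (N + 2) ^ 2 ^ k"
proof (induction k)
  case (Suc k)
  have "fsize N (Suc k) + 1 \<le> (fsize N k + 1) ^ 2"
    using fsize_pos[of N k] by (simp add: power2_eq_square)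
  also have "\<dots> \<le> ((N + 2) ^ 2 ^ k) ^ 2"
    using Suc by (rule power_mono) simp
  finally show ?case
    by (simp add: power_mult[symmetric] mult.commute)
qed simp

text \<open>The range splits into \<open>m\<close> blocks of length \<open>k\<close>. This serves
  both the entries of a tensor square and the pairs (coordinate, value).\<close>

lemma sum_div_mod:
  fixes f :: "nat \<Rightarrow> nat \<Rightarrow> 'a::comm_monoid_add"
  shows "(\<Sum>r<m * k. f (r div k) (r mod k)) = (\<Sum>a<m. \<Sum>b<k. f a b)"
proof -
  have "(\<Sum>r\<in>{a * k..<a * k + k}. f (r div k) (r mod k)) = (\<Sum>b<k. f a b)" for a
  proof -
    have "(\<Sum>r\<in>{a * k..<a * k + k}. f (r div k) (r mod k)) =
        (\<Sum>b\<in>{0..<k}. f ((b + a * k) div k) ((b + a * k) mod k))"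
      using sum.shift_bounds_nat_ivl[of "\<lambda>r. f (r div k) (r mod k)" 0 "a * k" k] by (simp add: add.commute)
    also have "\<dots> = (\<Sum>b<k. f a b)"
      by (rule sum.cong) auto
    finally show ?thesis .
  qed
  then show ?thesis
    by (simp flip: sum.nat_group)
qed

text \<open>The inner product of tensor squares is the square of the inner product. The column side
  contributes the factor 2, and the extra entries 1 and -1 contribute the summand -1.\<close>

lemma sum_feat_mult_feat:
  "(\<Sum>r<fsize N k. feat 1 1 1 N u k r * feat \<alpha> 2 (-1) N v k r) = cheb (\<alpha> + (\<Sum>r<N. u r * v r)) k"
proof (induction k)
  case 0
  show ?case by (simp add: add.commute)
next
  case (Suc k)
  let ?R = "fsize N k" and ?f = "feat 1 1 1 N u k" and ?g = "feat \<alpha> 2 (-1) N v k"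
  have "(\<Sum>r<fsize N (Suc k). feat 1 1 1 N u (Suc k) r * feat \<alpha> 2 (-1) N v (Suc k) r) =
     (\<Sum>r<?R * ?R. (?f (r div ?R) * ?f (r mod ?R)) * (2 * (?g (r div ?R) * ?g (r mod ?R)))) - 1"
    by simp
  also have "(\<Sum>r<?R * ?R. (?f (r div ?R) * ?f (r mod ?R)) * (2 * (?g (r div ?R) * ?g (r mod ?R)))) =
     (\<Sum>a<?R. \<Sum>b<?R. (?f a * ?f b) * (2 * (?g a * ?g b)))"
    by (rule sum_div_mod)
  also have "\<dots> = 2 * (\<Sum>a<?R. ?f a * ?g a) * (\<Sum>b<?R. ?f b * ?g b)"
    by (simp add: sum_product sum_distrib_left mult_ac)
  finally show ?case
    using Suc by simp
qed

text \<open>For \<open>X = d * M \<ge> 2\<close> the vector length is at most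
  \<open>X ^ (3 * 2 ^ \<kappa>)\<close>, and \<open>2 ^ \<kappa>\<close> is at most
  \<open>1 + 2 * Z\<close>, where \<open>Z\<close> is the product in the exponent of the
  claim.\<close>

lemma fsize_time_bound:
  fixes M d \<kappa> :: nat and \<epsilon> :: real
  defines "L \<equiv> ln (real M * real d / \<epsilon>)"
  assumes "1 \<le> M" "1 \<le> d" "0 < \<epsilon>" "\<epsilon> < 1"
    and \<kappa>: "\<kappa> = 0 \<or> 2 \<le> d \<and> 2 ^ \<kappa> \<le> 2 * (sqrt (real d) * ln (2 * real M / \<epsilon>))"
  shows "real (M * (fsize (d * (M + 1)) \<kappa> * fsize (d * (M + 1)) \<kappa>)) \<le>
    9 * (real d * real M) powr (26 * (real M * sqrt (real d) * L))"
proof (cases "d * M = 1")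
  case True
  then have "d = 1" "M = 1" by auto
  with \<kappa> show ?thesis by simp
next
  case False
  define X where "X = d * M"
  define R where "R = fsize (d * (M + 1)) \<kappa>"
  define Z where "Z = real M * sqrt (real d) * L"
  have "0 < d * M" using assms by simp
  with False have X: "2 \<le> X"
    unfolding X_def by linarith
  have dX: "d \<le> X" "M \<le> X" using assms by (simp_all add: X_def)
  \<comment> \<open>A positive lower bound on \<open>L\<close>, hence on \<open>Z\<close>, lets
    additive constants in the exponent be absorbed by a multiple of \<open>Z\<close>.\<close>
  have L: "1 / 2 \<le> L"
  proof -
    have "real X * \<epsilon> \<le> real X * 1"
      using assms by (intro mult_left_mono) auto
    then have "real X \<le> real X / \<epsilon>"
      using assms by (simp add: field_simps)
    then have "2 \<le> real X / \<epsilon>"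
      using X by linarith
    then have "2 \<le> real M * real d / \<epsilon>"
      by (simp add: X_def mult.commute)
    then have "ln 2 \<le> L"
      unfolding L_def by (intro ln_mono) auto
    moreover have "exp (1 / 2) \<le> (2 :: real)"
      using exp_bound[of "1 / 2"] by (simp add: power2_eq_square)
    then have "1 / 2 \<le> ln (2 :: real)"
      by (subst ln_ge_iff) auto
    ultimately show ?thesis by linarith
  qed
  have sd: "1 \<le> sqrt (real d)" using assms by simp
  have LZ: "sqrt (real d) * L \<le> Z"
    using mult_right_mono[of 1 "real M" "sqrt (real d) * L"] assms(2) sd L by (simp add: Z_def mult.assoc)
  have LL: "L \<le> sqrt (real d) * L"
    using mult_right_mono[of 1 "sqrt (real d)" L] sd L by simp
  have Z: "1 / 2 \<le> Z"
    using L LL LZ by linarith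
  have k: "2 ^ \<kappa> \<le> 1 + 2 * Z"
    using \<kappa>
  proof
    assume "\<kappa> = 0" then show ?thesis using Z by simp
  next
    assume *: "2 \<le> d \<and> 2 ^ \<kappa> \<le> 2 * (sqrt (real d) * ln (2 * real M / \<epsilon>))"
    \<comment> \<open>This uses \<open>d \<ge> 2\<close>, which is available whenever
      \<open>\<kappa>\<close> is positive.\<close>
    then have "2 * real M \<le> real M * real d"
      using mult_left_mono[of 2 "real d" "real M"] by simp
    then have "2 * real M / \<epsilon> \<le> real M * real d / \<epsilon>"
      using assms by (intro divide_right_mono) auto
    then have "ln (2 * real M / \<epsilon>) \<le> L"
      unfolding L_def using assms by (intro ln_mono) auto
    then have "sqrt (real d) * ln (2 * real M / \<epsilon>) \<le> sqrt (real d) * L"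
      by (intro mult_left_mono) auto
    with * LZ show ?thesis by linarith
  qed
  have "d * (M + 1) + 2 = X + d + 2"
    by (simp add: X_def)
  also have "\<dots> \<le> 3 * X"
    using dX X by linarith
  also have "\<dots> \<le> (2 * 2) * X" by simp
  also have "\<dots> \<le> (X * X) * X"
    using X by (intro mult_mono) auto
  finally have "d * (M + 1) + 2 \<le> X ^ 3" by (simp add: power3_eq_cube)
  then have "(d * (M + 1) + 2) ^ 2 ^ \<kappa> \<le> (X ^ 3) ^ 2 ^ \<kappa>"
    by (rule power_mono) simp
  moreover have "R + 1 \<le> (d * (M + 1) + 2) ^ 2 ^ \<kappa>"
    unfolding R_def by (rule fsize_le)
  ultimately have "R \<le> (X ^ 3) ^ 2 ^ \<kappa>"
    by linarith
  then have R: "R \<le> X ^ (3 * 2 ^ \<kappa>)"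
    by (simp only: power_mult)
  have "M * (R * R) \<le> X * (X ^ (3 * 2 ^ \<kappa>) * X ^ (3 * 2 ^ \<kappa>))"
    by (intro mult_mono dX R) auto
  also have "\<dots> = X ^ (1 + 6 * 2 ^ \<kappa>)"
    by (simp flip: power_add)
  finally have "real (M * (R * R)) \<le> real X ^ (1 + 6 * 2 ^ \<kappa>)"
    by (metis of_nat_le_iff of_nat_power)
  also have "\<dots> = real X powr real (1 + 6 * 2 ^ \<kappa>)"
    using X by (intro powr_realpow[symmetric]) simp
  \<comment> \<open>The exponent is at most \<open>7 + 12 * Z\<close>, and
    \<open>7 \<le> 14 * Z\<close>.\<close>
  also have "\<dots> \<le> real X powr (26 * Z)"
    using X k Z by (intro powr_mono) auto
  also have "\<dots> \<le> 9 * real X powr (26 * Z)"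
    by simp
  finally show ?thesis
    by (simp add: R_def Z_def X_def)
qed

section \<open>Computing feature vectors\<close>

text \<open>Indices of \<open>G\<close> are produced by counting in \<open>p\<close>, because the machine cannot multiply naturals.\<close>

definition Expand :: "nexp \<Rightarrow> nexp \<Rightarrow> rexp \<Rightarrow> rexp \<Rightarrow> com" where
  "Expand e1 e2 f c =
    Seq (NSet ''p'' (NConst 0) (NConst 0))
   (Seq (For ''a'' e1 (For ''b'' e2
          (Seq (RSet ''G'' (V ''p'') f) (NSet ''p'' (NConst 0) (NAdd (V ''p'') (NConst 1))))))
   (Seq (RSet ''G'' (V ''p'') c)
   (Seq (NSet ''R'' (NConst 0) (NAdd (V ''p'') (NConst 1)))
        (For ''a'' (V ''R'') (RSet ''F'' (V ''a'') (RGet ''G'' (V ''a'')))))))"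

text \<open>The new vector is collected in \<open>G\<close> and copied to \<open>F\<close> only when
  complete, and \<open>R\<close> is set after the double loop. Hence \<open>f\<close> may read the
  old vector and \<open>e1\<close>, \<open>e2\<close> the old length.\<close>

lemma runs_within_Expand:
  fixes s :: store and m1 m2 :: nat
  defines "ag \<equiv> agree_off {''p'', ''a'', ''b''} {''G''} s"
  assumes e1: "\<And>s'. ag s' \<Longrightarrow> nval e1 s' = m1"
    and e2: "\<And>s'. ag s' \<Longrightarrow> nval e2 s' = m2"
    and c: "\<And>s'. ag s' \<Longrightarrow> rval c s' = cv"
    and f: "\<And>s'. ag s' \<Longrightarrow> nats s' ''a'' 0 < m1 \<Longrightarrow> nats s' ''b'' 0 < m2 \<Longrightarrow>
      rval f s' = g (nats s' ''a'' 0) (nats s' ''b'' 0)"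
    and m2: "1 \<le> m2"
    and T: "(m1 * m2 + 1) * (90 + 2 * ncost e1 + 2 * ncost e2 + rcost f + rcost c) \<le> T"
  shows "runs_within (Expand e1 e2 f c) s T (\<lambda>s'.
    agree_off {''p'', ''a'', ''b'', ''R''} {''F'', ''G''} s s' \<and>
    nats s' ''R'' 0 = m1 * m2 + 1 \<and>
    (\<forall>r < m1 * m2. reals s' ''F'' r = g (r div m2) (r mod m2)) \<and> reals s' ''F'' (m1 * m2) = cv)"
proof -
  \<comment> \<open>The counter \<open>p\<close> equals \<open>a * m2 + b\<close> throughout, so
    quotient and remainder by \<open>m2\<close> recover the loop indices.\<close>
  define Q where "Q s' \<longleftrightarrow> ag s' \<and>
    (\<forall>q < nats s' ''p'' 0. reals s' ''G'' q = g (q div m2) (q mod m2))" for s'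
  have inner: "runs_within (For ''b'' e2
      (Seq (RSet ''G'' (V ''p'') f) (NSet ''p'' (NConst 0) (NAdd (V ''p'') (NConst 1)))))
      s' (m2 * (9 + rcost f + ncost e2 + 10) + ncost e2 + 7)
      (\<lambda>s''. nats s'' ''a'' 0 = k \<and> Q s'' \<and> nats s'' ''p'' 0 = k * m2 + m2)"
    if k: "k < m1" and s': "Q s'" "nats s' ''p'' 0 = k * m2" "nats s' ''a'' 0 = k" for k s'
  proof (rule runs_within_For[where
      I = "\<lambda>l s''. nats s'' ''a'' 0 = k \<and> Q s'' \<and> nats s'' ''p'' 0 = k * m2 + l" and T = "9 + rcost f"])
    fix l s1
    assume l: "l < m2" and s1: "nats s1 ''a'' 0 = k \<and> Q s1 \<and> nats s1 ''p'' 0 = k * m2 + l"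
      and b: "nats s1 ''b'' 0 = l"
    have f1: "rval f s1 = g k l"
      using f[of s1] s1 b l k by (simp add: Q_def)
    have dm: "(k * m2 + l) div m2 = k" "(k * m2 + l) mod m2 = l"
      using l by simp_all
    have Q': "Q (nupd ''b'' 0 (Suc l) (nupd ''p'' 0 (Suc (k * m2 + l)) (rupd ''G'' (k * m2 + l) (g k l) s1)))"
      unfolding Q_def
    proof (intro conjI allI impI)
      show "ag (nupd ''b'' 0 (Suc l) (nupd ''p'' 0 (Suc (k * m2 + l)) (rupd ''G'' (k * m2 + l) (g k l) s1)))"
        using s1 by (simp add: Q_def ag_def agree_off_def)
    next
      fix q assume "q < nats (nupd ''b'' 0 (Suc l) (nupd ''p'' 0 (Suc (k * m2 + l))
        (rupd ''G'' (k * m2 + l) (g k l) s1))) ''p'' 0"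
      then consider "q = k * m2 + l" | "q < nats s1 ''p'' 0" "q \<noteq> k * m2 + l"
        using s1 by force
      then show "reals (nupd ''b'' 0 (Suc l) (nupd ''p'' 0 (Suc (k * m2 + l))
        (rupd ''G'' (k * m2 + l) (g k l) s1))) ''G'' q = g (q div m2) (q mod m2)"
      proof cases
        case 1
        then show ?thesis using dm by simp
      next
        case 2
        then show ?thesis using s1 by (simp add: Q_def)
      qed
    qed
    show "runs_within (Seq (RSet ''G'' (V ''p'') f) (NSet ''p'' (NConst 0) (NAdd (V ''p'') (NConst 1)))) s1
       (9 + rcost f) (\<lambda>s'. nats s' ''b'' 0 = l \<and> nats (nupd ''b'' 0 (Suc l) s') ''a'' 0 = k \<and>
         Q (nupd ''b'' 0 (Suc l) s') \<and> nats (nupd ''b'' 0 (Suc l) s') ''p'' 0 = k * m2 + Suc l)"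
      by (rule runs_within_RSet_Seq[where T' = 6], rule runs_within_NSet)
        (use s1 b Q' in \<open>simp_all add: f1\<close>)
  next
    fix l s1 assume "nats s1 ''a'' 0 = k \<and> Q s1 \<and> nats s1 ''p'' 0 = k * m2 + l"
    then show "nval e2 s1 = m2" by (simp add: Q_def e2)
  next
    show "nats (nupd ''b'' 0 0 s') ''a'' 0 = k \<and> Q (nupd ''b'' 0 0 s') \<and>
      nats (nupd ''b'' 0 0 s') ''p'' 0 = k * m2 + 0"
      using s' by (simp add: Q_def ag_def agree_off_def)
  qed simp
  define T1 where "T1 = m2 * (9 + rcost f + ncost e2 + 10) + ncost e2 + 7"
  have outer: "runs_within (For ''a'' e1 (For ''b'' e2
      (Seq (RSet ''G'' (V ''p'') f) (NSet ''p'' (NConst 0) (NAdd (V ''p'') (NConst 1))))))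
      s' (m1 * (T1 + ncost e1 + 10) + ncost e1 + 7)
      (\<lambda>s''. Q s'' \<and> nats s'' ''p'' 0 = m1 * m2)"
    if s': "Q s'" "nats s' ''p'' 0 = 0" for s'
  proof (rule runs_within_For[where I = "\<lambda>l s''. Q s'' \<and> nats s'' ''p'' 0 = l * m2" and T = T1])
    fix k s1
    assume k: "k < m1" and s1: "Q s1 \<and> nats s1 ''p'' 0 = k * m2" "nats s1 ''a'' 0 = k"
    show "runs_within (For ''b'' e2
      (Seq (RSet ''G'' (V ''p'') f) (NSet ''p'' (NConst 0) (NAdd (V ''p'') (NConst 1))))) s1 T1
      (\<lambda>s'. nats s' ''a'' 0 = k \<and> Q (nupd ''a'' 0 (Suc k) s') \<and> nats (nupd ''a'' 0 (Suc k) s') ''p'' 0 = Suc k * m2)"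
      unfolding T1_def
      by (rule runs_within_mono[OF inner[OF k]])
        (use s1 in \<open>auto simp: Q_def ag_def agree_off_def\<close>)
  qed (use s' in \<open>auto simp: Q_def ag_def agree_off_def intro!: e1[unfolded ag_def agree_off_def]\<close>)
  define s0 where "s0 = nupd ''p'' 0 0 s"
  have s0: "Q s0" "nats s0 ''p'' 0 = 0"
    by (auto simp: Q_def ag_def agree_off_def s0_def)
  have last: "runs_within (For ''a'' (V ''R'') (RSet ''F'' (V ''a'') (RGet ''G'' (V ''a'')))) s'
      ((m1 * m2 + 1) * (6 + ncost (V ''R'') + 10) + ncost (V ''R'') + 7)
      (\<lambda>s''. agree_off {''a''} {''F''} s' s'' \<and> (\<forall>r < m1 * m2 + 1. reals s'' ''F'' r = reals s' ''G'' r))"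
    if R: "nats s' ''R'' 0 = m1 * m2 + 1" for s'
  proof (rule runs_within_For[where I = "\<lambda>k s''. agree_off {''a''} {''F''} s' s'' \<and>
        (\<forall>r < k. reals s'' ''F'' r = reals s' ''G'' r)"])
    fix k s1 assume "k < m1 * m2 + 1" and s1: "agree_off {''a''} {''F''} s' s1 \<and>
        (\<forall>r < k. reals s1 ''F'' r = reals s' ''G'' r)" "nats s1 ''a'' 0 = k"
    show "runs_within (RSet ''F'' (V ''a'') (RGet ''G'' (V ''a''))) s1 6 (\<lambda>s2. nats s2 ''a'' 0 = k \<and>
       agree_off {''a''} {''F''} s' (nupd ''a'' 0 (Suc k) s2) \<and>
        (\<forall>r < Suc k. reals (nupd ''a'' 0 (Suc k) s2) ''F'' r = reals s' ''G'' r))"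
      by (rule runs_within_RSet) (use s1 in \<open>auto simp: less_Suc_eq agree_off_def\<close>)
  qed (use R in \<open>auto simp: agree_off_def\<close>)
  define T2 where "T2 = (m1 * m2 + 1) * (6 + ncost (V ''R'') + 10) + ncost (V ''R'') + 7"
  have "runs_within (Expand e1 e2 f c) s
      (3 + ((m1 * (T1 + ncost e1 + 10) + ncost e1 + 7) + ((3 + rcost c) + (6 + T2)))) (\<lambda>s'.
    agree_off {''p'', ''a'', ''b'', ''R''} {''F'', ''G''} s s' \<and>
    nats s' ''R'' 0 = m1 * m2 + 1 \<and>
    (\<forall>r < m1 * m2. reals s' ''F'' r = g (r div m2) (r mod m2)) \<and> reals s' ''F'' (m1 * m2) = cv)"
    unfolding Expand_def
  proof (rule runs_within_NSet_Seq[where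
        T' = "(m1 * (T1 + ncost e1 + 10) + ncost e1 + 7) + ((3 + rcost c) + (6 + T2))"],
      rule runs_within_Seq[OF outer])
    fix s1 assume s1: "Q s1 \<and> nats s1 ''p'' 0 = m1 * m2"
    have c1: "rval c s1 = cv"
      using s1 c by (simp add: Q_def)
    define s2 where "s2 = nupd ''R'' 0 (m1 * m2 + 1) (rupd ''G'' (m1 * m2) cv s1)"
    have R: "nats s2 ''R'' 0 = m1 * m2 + 1"
      by (simp add: s2_def)
    have ag2: "agree_off {''p'', ''a'', ''b'', ''R''} {''G''} s s2"
      using s1 by (simp add: s2_def Q_def ag_def agree_off_def)
    have G: "reals s2 ''G'' r = g (r div m2) (r mod m2)" if "r < m1 * m2" for r
      using s1 that by (simp add: s2_def Q_def)
    have cv: "reals s2 ''G'' (m1 * m2) = cv"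
      by (simp add: s2_def)
    have end_: "runs_within (For ''a'' (V ''R'') (RSet ''F'' (V ''a'') (RGet ''G'' (V ''a'')))) s2 T2 (\<lambda>s'.
      agree_off {''p'', ''a'', ''b'', ''R''} {''F'', ''G''} s s' \<and>
      nats s' ''R'' 0 = m1 * m2 + 1 \<and>
      (\<forall>r < m1 * m2. reals s' ''F'' r = g (r div m2) (r mod m2)) \<and> reals s' ''F'' (m1 * m2) = cv)"
      unfolding T2_def
    proof (rule runs_within_mono[OF last[OF R] order_refl], intro conjI)
      fix s' assume s': "agree_off {''a''} {''F''} s2 s' \<and>
        (\<forall>r < m1 * m2 + 1. reals s' ''F'' r = reals s2 ''G'' r)"
      show "agree_off {''p'', ''a'', ''b'', ''R''} {''F'', ''G''} s s'"
        by (rule agree_off_trans[OF ag2 conjunct1[OF s']]) auto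
      show "nats s' ''R'' 0 = m1 * m2 + 1"
        using s' R by (simp add: agree_off_def)
      show "\<forall>r < m1 * m2. reals s' ''F'' r = g (r div m2) (r mod m2)"
        using s' G by simp
      show "reals s' ''F'' (m1 * m2) = cv"
        using s' cv by simp
    qed
    show "runs_within (Seq (RSet ''G'' (V ''p'') c)
        (Seq (NSet ''R'' (NConst 0) (NAdd (V ''p'') (NConst 1)))
          (For ''a'' (V ''R'') (RSet ''F'' (V ''a'') (RGet ''G'' (V ''a'')))))) s1
      ((3 + rcost c) + (6 + T2)) (\<lambda>s'.
      agree_off {''p'', ''a'', ''b'', ''R''} {''F'', ''G''} s s' \<and>
      nats s' ''R'' 0 = m1 * m2 + 1 \<and>
      (\<forall>r < m1 * m2. reals s' ''F'' r = g (r div m2) (r mod m2)) \<and> reals s' ''F'' (m1 * m2) = cv)"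
      by (rule runs_within_RSet_Seq[where T' = "6 + T2"], rule runs_within_NSet_Seq[where T' = T2])
        (use end_ s1 c1 in \<open>simp_all add: s2_def\<close>)
  qed (use s0 in \<open>simp_all add: s0_def\<close>)
  moreover have "3 + ((m1 * (T1 + ncost e1 + 10) + ncost e1 + 7) + ((3 + rcost c) + (6 + T2)))
      \<le> (m1 * m2 + 1) * (90 + 2 * ncost e1 + 2 * ncost e2 + rcost f + rcost c)"
  proof -
    \<comment> \<open>The overhead per outer round is charged to the entries of that round, of which
      there is at least one.\<close>
    have "m1 \<le> m1 * m2" using m2 by simp
    then have "m1 * z \<le> m1 * m2 * z" for z by (rule mult_right_mono) simp
    from this[of "ncost e2 + ncost e1 + 17"] show ?thesis
      unfolding T1_def T2_def by (simp add: algebra_simps)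
  qed
  ultimately show ?thesis
    using T by (blast intro: runs_within_mono order_trans)
qed

text \<open>Truncated subtraction makes this 0 for \<open>d = 1\<close> and 1 for \<open>d \<ge> 2\<close>.\<close>

definition delta :: nexp where
  "delta = NSub (NConst 1) (NSub (NConst 2) (V ''d''))"

text \<open>The cell \<open>z\<close> is set to \<open>\<zeta>\<close> before \<open>al\<close> is
  evaluated, so \<open>al\<close> may refer to it. It then follows the Chebyshev recurrence
  alongside the vector and ends as the normalizing denominator.\<close>

definition Build :: "rexp \<Rightarrow> rexp \<Rightarrow> rexp \<Rightarrow> rexp \<Rightarrow> com" where
  "Build f al c e =
    Seq (RSet ''z'' (NConst 0) (RAdd (ROfNat (NConst 1)) (RDiv (ROfNat delta) (ROfNat (V ''d'')))))
   (Seq (Expand (V ''d'') (NAdd (V ''M'') (NConst 1)) f al)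
        (While (RLess (RMul (W ''z'') (W ''eps'')) (RMul (ROfNat (V ''M'')) (ROfNat delta)))
          (Seq (Expand (V ''R'') (V ''R'') (RMul c (RMul (RGet ''F'' (V ''a'')) (RGet ''F'' (V ''b'')))) e)
               (RSet ''z'' (NConst 0)
                 (RSub (RMul (RMul (ROfNat (NConst 2)) (W ''z'')) (W ''z'')) (ROfNat (NConst 1)))))))"

text \<open>One factor \<open>R\<close> in the time bounds the work of a round, the other the number
  of rounds. \<open>c\<close> and \<open>e\<close> are evaluated in all rounds and must be constant;
  \<open>f\<close> and \<open>al\<close> are evaluated only in the initial expansion.\<close>

lemma runs_within_Build:
  fixes d M \<kappa> :: nat and s :: store and \<epsilon> \<zeta> :: real
  defines "N \<equiv> d * (M + 1)" and "R \<equiv> fsize (d * (M + 1)) \<kappa>"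
    and "ag \<equiv> agree_off {''p'', ''a'', ''b''} {''G''} (rupd ''z'' 0 \<zeta> s)"
  assumes s: "nats s ''d'' 0 = d" "nats s ''M'' 0 = M" "reals s ''eps'' 0 = \<epsilon>"
    and d: "1 \<le> d"
    and \<zeta>: "\<zeta> = 1 + real (1 - (2 - d)) / real d"
    and \<kappa>: "\<And>k. k < \<kappa> \<Longrightarrow> cheb \<zeta> k * \<epsilon> < real M * real (1 - (2 - d))"
      "\<not> cheb \<zeta> \<kappa> * \<epsilon> < real M * real (1 - (2 - d))"
    and f: "\<And>s'. ag s' \<Longrightarrow> nats s' ''a'' 0 < d \<Longrightarrow> nats s' ''b'' 0 < M + 1 \<Longrightarrow>
      rval f s' = g (nats s' ''a'' 0) (nats s' ''b'' 0)"
    and al: "\<And>s'. ag s' \<Longrightarrow> rval al s' = \<alpha>"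
    and ce: "\<And>s'. rval c s' = c'" "\<And>s'. rval e s' = e'"
    and T: "R * R * (200 + rcost f + rcost al + rcost c + rcost e) \<le> T"
  shows "runs_within (Build f al c e) s T (\<lambda>s'.
    agree_off {''p'', ''a'', ''b'', ''R''} {''F'', ''G'', ''z''} s s' \<and>
    nats s' ''R'' 0 = R \<and> reals s' ''z'' 0 = cheb \<zeta> \<kappa> \<and>
    (\<forall>r < R. reals s' ''F'' r = feat \<alpha> c' e' N (\<lambda>r. g (r div (M + 1)) (r mod (M + 1))) \<kappa> r))"
proof -
  define u where "u = (\<lambda>r. g (r div (M + 1)) (r mod (M + 1)))"
  define I where "I k s' \<longleftrightarrow> agree_off {''p'', ''a'', ''b'', ''R''} {''F'', ''G'', ''z''} s s' \<and>
    nats s' ''R'' 0 = fsize N k \<and> reals s' ''z'' 0 = cheb \<zeta> k \<and>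
    (\<forall>r < fsize N k. reals s' ''F'' r = feat \<alpha> c' e' N u k r)" for k s'
  define s1 where "s1 = rupd ''z'' 0 \<zeta> s"
  define b where "b = RLess (RMul (W ''z'') (W ''eps'')) (RMul (ROfNat (V ''M'')) (ROfNat delta))"
  define sq where "sq = Expand (V ''R'') (V ''R'') (RMul c (RMul (RGet ''F'' (V ''a'')) (RGet ''F'' (V ''b'')))) e"
  define zs where "zs = RSub (RMul (RMul (ROfNat (NConst 2)) (W ''z'')) (W ''z'')) (ROfNat (NConst 1))"
  have init: "runs_within (Expand (V ''d'') (NAdd (V ''M'') (NConst 1)) f al) s1
    ((N + 1) * (102 + rcost f + rcost al)) (I 0)"
  proof (rule runs_within_mono[OF runs_within_Expand[where g = g and ?m1.0 = d and ?m2.0 = "M + 1" and cv = \<alpha>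
        and T = "(N + 1) * (102 + rcost f + rcost al)"]])
    fix s' assume s': "agree_off {''p'', ''a'', ''b'', ''R''} {''F'', ''G''} s1 s' \<and>
       nats s' ''R'' 0 = d * (M + 1) + 1 \<and>
       (\<forall>r<d * (M + 1). reals s' ''F'' r = g (r div (M + 1)) (r mod (M + 1))) \<and>
       reals s' ''F'' (d * (M + 1)) = \<alpha>"
    show "I 0 s'"
      unfolding I_def
    proof (intro conjI allI impI)
      show "agree_off {''p'', ''a'', ''b'', ''R''} {''F'', ''G'', ''z''} s s'"
        using s' by (simp add: agree_off_def s1_def)
      show "nats s' ''R'' 0 = fsize N 0" using s' by (simp add: N_def)
      show "reals s' ''z'' 0 = cheb \<zeta> 0" using s' by (simp add: agree_off_def s1_def)
      fix r assume "r < fsize N 0"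
      then have "r < N \<or> r = N" by auto
      then show "reals s' ''F'' r = feat \<alpha> c' e' N u 0 r"
        using s' unfolding N_def u_def by auto
    qed
  next
    fix s' assume s': "agree_off {''p'', ''a'', ''b''} {''G''} s1 s'"
    then have ag: "ag s'" by (simp add: ag_def s1_def)
    show "nval (V ''d'') s' = d" "nval (NAdd (V ''M'') (NConst 1)) s' = M + 1"
      using s' s by (simp_all add: agree_off_def s1_def)
    show "rval al s' = \<alpha>" by (rule al[OF ag])
    show "rval f s' = g (nats s' ''a'' 0) (nats s' ''b'' 0)"
      if "nats s' ''a'' 0 < d" "nats s' ''b'' 0 < M + 1"
      using f[OF ag that] .
  qed (simp_all add: N_def)
  have step: "bval b s' \<and> runs_within (Seq sq (RSet ''z'' (NConst 0) zs)) s'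
      (R * (106 + rcost c + rcost e) + 13) (I (Suc k))"
    if k: "k < \<kappa>" and s': "I k s'" for k s'
  proof
    have eqs: "reals s' ''eps'' 0 = \<epsilon>" "nats s' ''M'' 0 = M" "nats s' ''d'' 0 = d"
      using s' s by (simp_all add: I_def agree_off_def)
    show "bval b s'"
      using \<kappa>(1)[OF k] s' eqs by (simp add: b_def I_def delta_def)
    \<comment> \<open>The left side is the length after the next squaring, which is at most the
      final length.\<close>
    have R: "fsize N k * fsize N k + 1 \<le> R"
      using fsize_mono[of "Suc k" \<kappa> N] k by (simp add: R_def N_def)
    show "runs_within (Seq sq (RSet ''z'' (NConst 0) zs)) s'
      (R * (106 + rcost c + rcost e) + 13) (I (Suc k))"
      unfolding sq_def
    proof (rule runs_within_Seq[OF runs_within_Expand[where ?m1.0 = "fsize N k" and ?m2.0 = "fsize N k"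
        and cv = e' and g = "\<lambda>a b. c' * (feat \<alpha> c' e' N u k a * feat \<alpha> c' e' N u k b)"]])
      fix s2 assume s2: "agree_off {''p'', ''a'', ''b''} {''G''} s' s2"
      show "nval (V ''R'') s2 = fsize N k" "nval (V ''R'') s2 = fsize N k"
        using s2 s' by (simp_all add: agree_off_def I_def)
      show "rval e s2 = e'" by (rule ce)
      show "rval (RMul c (RMul (RGet ''F'' (V ''a'')) (RGet ''F'' (V ''b'')))) s2 =
        c' * (feat \<alpha> c' e' N u k (nats s2 ''a'' 0) * feat \<alpha> c' e' N u k (nats s2 ''b'' 0))"
        if "nats s2 ''a'' 0 < fsize N k" "nats s2 ''b'' 0 < fsize N k"
        using that s2 s' by (simp add: agree_off_def I_def ce)
    next
      show "1 \<le> fsize N k" by (rule fsize_pos)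
      show "(fsize N k * fsize N k + 1) * (90 + 2 * ncost (V ''R'') + 2 * ncost (V ''R'') +
        rcost (RMul c (RMul (RGet ''F'' (V ''a'')) (RGet ''F'' (V ''b'')))) + rcost e)
        \<le> R * (106 + rcost c + rcost e)"
        by (rule mult_mono[OF R]) auto
    next
      fix s2 assume s2: "agree_off {''p'', ''a'', ''b'', ''R''} {''F'', ''G''} s' s2 \<and>
        nats s2 ''R'' 0 = fsize N k * fsize N k + 1 \<and>
        (\<forall>r<fsize N k * fsize N k. reals s2 ''F'' r =
          c' * (feat \<alpha> c' e' N u k (r div fsize N k) * feat \<alpha> c' e' N u k (r mod fsize N k))) \<and>
        reals s2 ''F'' (fsize N k * fsize N k) = e'"
      have z: "reals s2 ''z'' 0 = cheb \<zeta> k"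
        using s2 s' by (simp add: agree_off_def I_def)
      have "I (Suc k) (rupd ''z'' 0 (2 * cheb \<zeta> k * cheb \<zeta> k - 1) s2)"
        unfolding I_def
      proof (intro conjI allI impI)
        show "agree_off {''p'', ''a'', ''b'', ''R''} {''F'', ''G'', ''z''} s
          (rupd ''z'' 0 (2 * cheb \<zeta> k * cheb \<zeta> k - 1) s2)"
          using s2 s' by (simp add: agree_off_def I_def)
        fix r assume "r < fsize N (Suc k)"
        then have "r < fsize N k * fsize N k \<or> r = fsize N k * fsize N k"
          by auto
        then show "reals (rupd ''z'' 0 (2 * cheb \<zeta> k * cheb \<zeta> k - 1) s2) ''F'' r =
            feat \<alpha> c' e' N u (Suc k) r"
          using s2 by auto
      qed (use s2 in simp_all)
      then show "runs_within (RSet ''z'' (NConst 0) zs) s2 13 (I (Suc k))"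
        by (intro runs_within_RSet) (simp_all add: zs_def z)
    qed simp
  qed
  have stop: "\<not> bval b s'" if s': "I \<kappa> s'" for s'
  proof -
    have eqs: "reals s' ''eps'' 0 = \<epsilon>" "nats s' ''M'' 0 = M" "nats s' ''d'' 0 = d"
      using s' s by (simp_all add: I_def agree_off_def)
    show ?thesis
      using \<kappa>(2) s' eqs by (simp add: b_def I_def delta_def)
  qed
  define T1 where "T1 = (N + 1) * (102 + rcost f + rcost al)"
  define T2 where "T2 = R * (106 + rcost c + rcost e) + 13"
  have "runs_within (Build f al c e) s (18 + (T1 + (\<kappa> * (1 + bcost b + T2) + (1 + bcost b)))) (I \<kappa>)"
    unfolding Build_def b_def[symmetric] sq_def[symmetric] zs_def[symmetric]
  proof (rule runs_within_RSet_Seq[where T' = "T1 + (\<kappa> * (1 + bcost b + T2) + (1 + bcost b))"])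
    have Z: "rval (RAdd (ROfNat (NConst 1)) (RDiv (ROfNat delta) (ROfNat (V ''d'')))) s = \<zeta>"
      by (simp add: delta_def s \<zeta>)
    show "runs_within (Seq (Expand (V ''d'') (NAdd (V ''M'') (NConst 1)) f al)
         (While b (Seq sq (RSet ''z'' (NConst 0) zs))))
       (rupd ''z'' (nval (NConst 0) s) (rval (RAdd (ROfNat (NConst 1)) (RDiv (ROfNat delta) (ROfNat (V ''d'')))) s) s)
       (T1 + (\<kappa> * (1 + bcost b + T2) + (1 + bcost b))) (I \<kappa>)"
      unfolding Z nval.simps s1_def[symmetric]
      by (rule runs_within_Seq[OF init[folded T1_def] runs_within_While[where I = I and N = \<kappa>, OF _ step[folded T2_def] stop]]) auto
  qed (simp add: delta_def)
  then show ?thesis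
  proof (rule runs_within_mono)
    have N1: "1 \<le> N" using d by (simp add: N_def)
    have 1: "N + 1 \<le> R"
      using fsize_mono[of 0 \<kappa> N] by (simp add: R_def N_def)
    have 2: "\<kappa> + 1 \<le> R"
      using less_fsize[OF N1, of \<kappa>] by (simp add: R_def N_def)
    define Y where "Y = 200 + rcost f + rcost al + rcost c + rcost e"
    have bc: "bcost b = 17" by (simp add: b_def delta_def)
    \<comment> \<open>The initial part and each of the \<open>\<kappa>\<close> rounds cost at most
      \<open>R * Y\<close>.\<close>
    have "18 + (T1 + (\<kappa> * (1 + bcost b + T2) + (1 + bcost b))) \<le> (\<kappa> + 1) * (R * Y)"
    proof -
      have "R \<ge> 1" using 2 by simp
      then have R32: "32 \<le> R * 32" "37 \<le> R * 37" by auto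
      have "T1 \<le> R * (102 + rcost f + rcost al)"
        unfolding T1_def by (rule mult_right_mono[OF 1]) simp
      then have a: "37 + T1 \<le> R * Y"
        using R32 by (simp add: Y_def algebra_simps)
      have "19 + T2 \<le> R * Y"
        using R32 by (simp add: Y_def T2_def algebra_simps)
      then have "\<kappa> * (19 + T2) \<le> \<kappa> * (R * Y)"
        by (rule mult_left_mono) simp
      with a show ?thesis
        by (simp add: bc algebra_simps)
    qed
    also have "\<dots> \<le> R * (R * Y)"
      by (rule mult_right_mono[OF 2]) simp
    finally show "18 + (T1 + (\<kappa> * (1 + bcost b + T2) + (1 + bcost b))) \<le> T"
      using T by (simp add: Y_def mult.assoc)
  next
    fix s' assume "I \<kappa> s'"
    then show "agree_off {''p'', ''a'', ''b'', ''R''} {''F'', ''G'', ''z''} s s' \<and>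
      nats s' ''R'' 0 = R \<and> reals s' ''z'' 0 = cheb \<zeta> \<kappa> \<and>
      (\<forall>r < R. reals s' ''F'' r = feat \<alpha> c' e' N (\<lambda>r. g (r div (M + 1)) (r mod (M + 1))) \<kappa> r)"
      by (simp add: I_def R_def N_def u_def)
  qed
qed

section \<open>The query program\<close>

text \<open>At least one of the truncated differences is 0, so the sum is the absolute difference of
  \<open>b\<close> and coordinate \<open>a\<close> of the current point.\<close>

definition gap :: nexp where
  "gap = NAdd (NSub (V ''b'') (NGet ''x'' (NAdd (V ''q'') (V ''a''))))
              (NSub (NGet ''x'' (NAdd (V ''q'') (V ''a''))) (V ''b''))"

text \<open>
  By truncation, \<open>1 - (t + 1 - gap)\<close> is the indicator of \<open>t < gap\<close>, and \<open>1 - gap\<close> that of \<open>gap = 0\<close>.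
  The cell \<open>q\<close> holds the offset \<open>j * d\<close> of the current point.
\<close>

definition Column :: com where
  "Column =
    Seq (Build (RDiv (RSub (ROfNat (NConst 0))
                  (ROfNat (NSub (NConst 1) (NSub (NAdd (V ''t'') (NConst 1)) gap)))) (ROfNat (V ''d'')))
               (W ''z'') (ROfNat (NConst 2)) (RSub (ROfNat (NConst 0)) (ROfNat (NConst 1))))
   (Seq (RSet ''w'' (NConst 0) (RAdd (W ''w'') (RGet ''y'' (V ''j''))))
   (Seq (For ''r'' (V ''R'') (RSet ''S'' (V ''r'')
           (RAdd (RGet ''S'' (V ''r'')) (RMul (RGet ''y'' (V ''j'')) (RGet ''F'' (V ''r''))))))
        (NSet ''q'' (NConst 0) (NAdd (V ''q'') (V ''d'')))))"

text \<open>The cell \<open>w\<close> holds the contribution of the constants 1 in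
  \<open>1 - T / T \<zeta>\<close>. From it the loop subtracts the inner product with the
  accumulated columns, divided by the value that \<open>Build\<close> leaves in
  \<open>z\<close>.\<close>

definition Row :: com where
  "Row =
    Seq (Build (ROfNat (NSub (NConst 1) gap))
               (ROfNat (NConst 1)) (ROfNat (NConst 1)) (ROfNat (NConst 1)))
   (Seq (RSet ''out'' (V ''j'') (W ''w''))
   (Seq (For ''r'' (V ''R'') (RSet ''out'' (V ''j'')
           (RSub (RGet ''out'' (V ''j''))
             (RDiv (RMul (RGet ''F'' (V ''r'')) (RGet ''S'' (V ''r''))) (W ''z'')))))
        (NSet ''q'' (NConst 0) (NAdd (V ''q'') (V ''d'')))))"

text \<open>Row features do not depend on the threshold \<open>t\<close>. So the columns of all
  thresholds go into a single vector \<open>S\<close>, and one pass over the rows suffices.\<close>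

definition Query :: com where
  "Query =
    Seq (For ''t'' (V ''M'') (Seq (NSet ''q'' (NConst 0) (NConst 0)) (For ''j'' (V ''n'') Column)))
   (Seq (NSet ''q'' (NConst 0) (NConst 0)) (For ''j'' (V ''n'') Row))"

section \<open>Semantics and running time of the query program\<close>

locale query_run =
  fixes M d n \<kappa> :: nat and \<epsilon> \<zeta> :: real and xs :: "nat vec list" and y :: "real vec"
  assumes d: "1 \<le> d" and M: "1 \<le> M" and n: "1 \<le> n"
    and len: "length xs = n" and y: "y \<in> carrier_vec n"
    and \<zeta>: "\<zeta> = 1 + real (1 - (2 - d)) / real d"
    and less_\<kappa>: "\<And>k. k < \<kappa> \<Longrightarrow> cheb \<zeta> k * \<epsilon> < real M * real (1 - (2 - d))"
    and \<kappa>: "\<not> cheb \<zeta> \<kappa> * \<epsilon> < real M * real (1 - (2 - d))"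
begin

definition N :: nat where "N = d * (M + 1)"
definition R :: nat where "R = fsize N \<kappa>"

definition dst :: "nat \<Rightarrow> nat \<Rightarrow> nat \<Rightarrow> nat" where
  "dst j a b = (b - xs ! j $ a) + (xs ! j $ a - b)"

definition same :: "nat \<Rightarrow> nat \<Rightarrow> nat \<Rightarrow> real" where
  "same j a b = real (1 - dst j a b)"

text \<open>Minus the indicator of \<open>t < dst j a b\<close>, scaled such that summing over the
  coordinates gives \<open>- cnt / d\<close>.\<close>

definition far :: "nat \<Rightarrow> nat \<Rightarrow> nat \<Rightarrow> nat \<Rightarrow> real" where
  "far t j a b = (0 - real (1 - (t + 1 - dst j a b))) / real d"

text \<open>The column vector. Its parameter \<open>\<zeta>\<close> makes the underlying inner
  product start from \<open>\<zeta>\<close>; \<open>phi\<close> below is the matching row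
  vector.\<close>

definition psi :: "nat \<Rightarrow> nat \<Rightarrow> nat \<Rightarrow> real" where
  "psi t j = feat \<zeta> 2 (-1) N (\<lambda>r. far t j (r div (M + 1)) (r mod (M + 1))) \<kappa>"

definition phi :: "nat \<Rightarrow> nat \<Rightarrow> real" where
  "phi j = feat 1 1 1 N (\<lambda>r. same j (r div (M + 1)) (r mod (M + 1))) \<kappa>"

text \<open>Only work arrays are listed, so the parameters, the points and the query vector stay
  intact throughout.\<close>

definition frame :: "store \<Rightarrow> bool" where
  "frame = agree_off {''t'', ''j'', ''q'', ''p'', ''a'', ''b'', ''r'', ''R''}
     {''F'', ''G'', ''z'', ''S'', ''w'', ''out''} (query_input M d \<epsilon> xs y)"

lemma frameD:
  assumes "frame s"
  shows "nats s ''n'' 0 = n" "nats s ''d'' 0 = d" "nats s ''M'' 0 = M" "reals s ''eps'' 0 = \<epsilon>"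
    and "j < n \<Longrightarrow> reals s ''y'' j = y $ j"
    and "j < n \<Longrightarrow> k < d \<Longrightarrow> nats s ''x'' (j * d + k) = xs ! j $ k"
proof -
  show "nats s ''x'' (j * d + k) = xs ! j $ k" if "j < n" "k < d"
  proof -
    have "j * d + k < Suc j * d" using that by simp
    also have "\<dots> \<le> n * d" using that by (intro mult_right_mono) auto
    finally have "j * d + k < n * d" .
    then show ?thesis
      using assms that by (simp add: frame_def agree_off_def query_input_def len)
  qed
qed (use assms y in \<open>auto simp: frame_def agree_off_def query_input_def len\<close>)

lemma R_pos: "1 \<le> R"
  unfolding R_def by (rule fsize_pos)

lemma runs_within_Column:
  assumes s: "frame s" "nats s ''t'' 0 = t" "nats s ''j'' 0 = j" "nats s ''q'' 0 = j * d" and j: "j < n"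
  shows "runs_within Column s (300 * (R * R)) (\<lambda>s'. frame s' \<and>
    nats s' ''t'' 0 = t \<and> nats s' ''j'' 0 = j \<and> nats s' ''q'' 0 = Suc j * d \<and>
    reals s' ''out'' = reals s ''out'' \<and> reals s' ''w'' 0 = reals s ''w'' 0 + y $ j \<and>
    (\<forall>r<R. reals s' ''S'' r = reals s ''S'' r + y $ j * psi t j r))"
  unfolding Column_def
proof (rule runs_within_Seq[OF runs_within_Build[where d = d and M = M and \<kappa> = \<kappa> and \<epsilon> = \<epsilon> and \<zeta> = \<zeta>
      and g = "far t j" and \<alpha> = \<zeta> and c' = 2 and e' = "-1" and T = "R * R * 250"]])
  fix s' assume s': "agree_off {''p'', ''a'', ''b''} {''G''} (rupd ''z'' 0 \<zeta> s) s'"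
  have frame: "frame s'"
    using s s' by (simp add: frame_def agree_off_def)
  have eqs: "nats s' ''q'' 0 = j * d" "nats s' ''t'' 0 = t"
    using s s' by (simp_all add: agree_off_def)
  show "rval (W ''z'') s' = \<zeta>"
    using s' by (simp add: agree_off_def)
  show "rval (RDiv (RSub (ROfNat (NConst 0))
      (ROfNat (NSub (NConst 1) (NSub (NAdd (V ''t'') (NConst 1)) gap)))) (ROfNat (V ''d''))) s' =
    far t j (nats s' ''a'' 0) (nats s' ''b'' 0)" if "nats s' ''a'' 0 < d" "nats s' ''b'' 0 < M + 1"
    using that by (simp add: far_def gap_def dst_def eqs frameD[OF frame] j)
next
  fix s1
  assume "agree_off {''p'', ''a'', ''b'', ''R''} {''F'', ''G'', ''z''} s s1 \<and>
    nats s1 ''R'' 0 = fsize (d * (M + 1)) \<kappa> \<and> reals s1 ''z'' 0 = cheb \<zeta> \<kappa> \<and>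
    (\<forall>r < fsize (d * (M + 1)) \<kappa>. reals s1 ''F'' r =
      feat \<zeta> 2 (-1) (d * (M + 1)) (\<lambda>r. far t j (r div (M + 1)) (r mod (M + 1))) \<kappa> r)"
  then have s1: "agree_off {''p'', ''a'', ''b'', ''R''} {''F'', ''G'', ''z''} s s1" "nats s1 ''R'' 0 = R"
    "\<And>r. r < R \<Longrightarrow> reals s1 ''F'' r = psi t j r"
    by (auto simp: R_def N_def psi_def)
  have frame1: "frame s1"
    using s s1(1) by (simp add: frame_def agree_off_def)
  have eqs: "nats s1 ''q'' 0 = j * d" "nats s1 ''t'' 0 = t" "nats s1 ''j'' 0 = j"
    using s s1(1) by (simp_all add: agree_off_def)
  define s2 where "s2 = rupd ''w'' 0 (reals s ''w'' 0 + y $ j) s1"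
  define I where "I k s' \<longleftrightarrow> agree_off {''r''} {''S''} s2 s' \<and>
    (\<forall>r<R. reals s' ''S'' r = reals s ''S'' r + (if r < k then y $ j * psi t j r else 0))" for k s'
  have loop: "runs_within (For ''r'' (V ''R'') (RSet ''S'' (V ''r'')
           (RAdd (RGet ''S'' (V ''r'')) (RMul (RGet ''y'' (V ''j'')) (RGet ''F'' (V ''r''))))))
    s2 (R * (14 + ncost (V ''R'') + 10) + ncost (V ''R'') + 7) (I R)"
  proof (rule runs_within_For)
    show "nval (V ''R'') s' = R" if "I k s'" for k s'
      using that s1 by (simp add: I_def agree_off_def s2_def)
    show "I 0 (nupd ''r'' 0 0 s2)"
      using s1(1) by (simp add: I_def agree_off_def s2_def)
    fix k s' assume k: "k < R" and s': "I k s'" "nats s' ''r'' 0 = k"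
    have "reals s' ''y'' j = y $ j" "reals s' ''F'' k = psi t j k" "nats s' ''j'' 0 = j"
      using s'(1) frameD(5)[OF frame1 j] s1(3)[OF k] eqs by (simp_all add: I_def agree_off_def s2_def)
    then show "runs_within (RSet ''S'' (V ''r'')
           (RAdd (RGet ''S'' (V ''r'')) (RMul (RGet ''y'' (V ''j'')) (RGet ''F'' (V ''r''))))) s' 14
        (\<lambda>s'. nats s' ''r'' 0 = k \<and> I (Suc k) (nupd ''r'' 0 (Suc k) s'))"
      using k s' by (intro runs_within_RSet) (auto simp: I_def agree_off_def less_Suc_eq)
  qed simp
  have w: "rval (RAdd (W ''w'') (RGet ''y'' (V ''j''))) s1 = reals s ''w'' 0 + y $ j"
    using s1(1) frameD(5)[OF frame1 j] eqs by (simp add: agree_off_def)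
  show "runs_within (Seq (RSet ''w'' (NConst 0) (RAdd (W ''w'') (RGet ''y'' (V ''j''))))
   (Seq (For ''r'' (V ''R'') (RSet ''S'' (V ''r'')
           (RAdd (RGet ''S'' (V ''r'')) (RMul (RGet ''y'' (V ''j'')) (RGet ''F'' (V ''r''))))))
        (NSet ''q'' (NConst 0) (NAdd (V ''q'') (V ''d''))))) s1 (8 + ((R * 26 + 9) + 7))
    (\<lambda>s'. frame s' \<and>
    nats s' ''t'' 0 = t \<and> nats s' ''j'' 0 = j \<and> nats s' ''q'' 0 = Suc j * d \<and>
    reals s' ''out'' = reals s ''out'' \<and> reals s' ''w'' 0 = reals s ''w'' 0 + y $ j \<and>
    (\<forall>r<R. reals s' ''S'' r = reals s ''S'' r + y $ j * psi t j r))"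
  proof (rule runs_within_RSet_Seq[where T' = "(R * 26 + 9) + 7"], unfold w nval.simps s2_def[symmetric],
      rule runs_within_Seq[OF loop])
    fix s' assume s': "I R s'"
    then have d': "nats s' ''d'' 0 = d"
      using frameD(2)[OF frame1] by (simp add: I_def agree_off_def s2_def)
    have "frame (nupd ''q'' 0 (j * d + d) s')"
      using s' frame1 by (simp add: I_def frame_def agree_off_def s2_def)
    then show "runs_within (NSet ''q'' (NConst 0) (NAdd (V ''q'') (V ''d''))) s' 7
     (\<lambda>s'. frame s' \<and>
      nats s' ''t'' 0 = t \<and> nats s' ''j'' 0 = j \<and> nats s' ''q'' 0 = Suc j * d \<and>
      reals s' ''out'' = reals s ''out'' \<and> reals s' ''w'' 0 = reals s ''w'' 0 + y $ j \<and>
      (\<forall>r<R. reals s' ''S'' r = reals s ''S'' r + y $ j * psi t j r))"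
      using s' d' eqs s1(1) by (intro runs_within_NSet) (simp_all add: I_def agree_off_def s2_def)
  qed simp_all
next
  \<comment> \<open>The \<open>26 * R + 24\<close> steps after \<open>Build\<close> are at most
    \<open>50 * (R * R)\<close>.\<close>
  have "R * 1 \<le> R * R" "1 * 1 \<le> R * R"
    using R_pos by (intro mult_mono; simp)+
  then show "R * R * 250 + (8 + ((R * 26 + 9) + 7)) \<le> 300 * (R * R)"
    by linarith
qed (use s frameD[OF s(1)] d \<zeta> less_\<kappa> \<kappa> in \<open>simp_all add: R_def N_def gap_def\<close>)

lemma runs_within_Row:
  assumes s: "frame s" "nats s ''j'' 0 = j" "nats s ''q'' 0 = j * d" and j: "j < n"
  shows "runs_within Row s (300 * (R * R)) (\<lambda>s'. frame s' \<and>
    nats s' ''j'' 0 = j \<and> nats s' ''q'' 0 = Suc j * d \<and>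
    reals s' ''w'' = reals s ''w'' \<and> reals s' ''S'' = reals s ''S'' \<and>
    reals s' ''out'' = (reals s ''out'')(j :=
      reals s ''w'' 0 - (\<Sum>r<R. phi j r * reals s ''S'' r / cheb \<zeta> \<kappa>)))"
  unfolding Row_def
proof (rule runs_within_Seq[OF runs_within_Build[where d = d and M = M and \<kappa> = \<kappa> and \<epsilon> = \<epsilon> and \<zeta> = \<zeta>
      and g = "same j" and \<alpha> = 1 and c' = 1 and e' = 1 and T = "R * R * 240"]])
  fix s' assume s': "agree_off {''p'', ''a'', ''b''} {''G''} (rupd ''z'' 0 \<zeta> s) s'"
  have frame: "frame s'"
    using s s' by (simp add: frame_def agree_off_def)
  have q: "nats s' ''q'' 0 = j * d"
    using s s' by (simp_all add: agree_off_def)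
  show "rval (ROfNat (NSub (NConst 1) gap)) s' = same j (nats s' ''a'' 0) (nats s' ''b'' 0)"
    if "nats s' ''a'' 0 < d" "nats s' ''b'' 0 < M + 1"
    using that by (simp add: same_def gap_def dst_def q frameD[OF frame] j)
next
  fix s1
  assume "agree_off {''p'', ''a'', ''b'', ''R''} {''F'', ''G'', ''z''} s s1 \<and>
    nats s1 ''R'' 0 = fsize (d * (M + 1)) \<kappa> \<and> reals s1 ''z'' 0 = cheb \<zeta> \<kappa> \<and>
    (\<forall>r < fsize (d * (M + 1)) \<kappa>. reals s1 ''F'' r =
      feat 1 1 1 (d * (M + 1)) (\<lambda>r. same j (r div (M + 1)) (r mod (M + 1))) \<kappa> r)"
  then have s1: "agree_off {''p'', ''a'', ''b'', ''R''} {''F'', ''G'', ''z''} s s1" "nats s1 ''R'' 0 = R"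
    "\<And>r. r < R \<Longrightarrow> reals s1 ''F'' r = phi j r" and z: "reals s1 ''z'' 0 = cheb \<zeta> \<kappa>"
    by (auto simp: R_def N_def phi_def)
  have frame1: "frame s1"
    using s s1(1) by (simp add: frame_def agree_off_def)
  have eqs: "nats s1 ''q'' 0 = j * d" "nats s1 ''j'' 0 = j"
    using s s1(1) by (simp_all add: agree_off_def)
  define s2 where "s2 = rupd ''out'' j (reals s ''w'' 0) s1"
  define I where "I k s' \<longleftrightarrow> agree_off {''r''} {''out''} s2 s' \<and>
    reals s' ''out'' = (reals s ''out'')(j :=
      reals s ''w'' 0 - (\<Sum>r<k. phi j r * reals s ''S'' r / cheb \<zeta> \<kappa>))" for k s'
  have loop: "runs_within (For ''r'' (V ''R'') (RSet ''out'' (V ''j'')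
           (RSub (RGet ''out'' (V ''j''))
             (RDiv (RMul (RGet ''F'' (V ''r'')) (RGet ''S'' (V ''r''))) (W ''z'')))))
    s2 (R * (17 + ncost (V ''R'') + 10) + ncost (V ''R'') + 7) (I R)"
  proof (rule runs_within_For)
    show "nval (V ''R'') s' = R" if "I k s'" for k s'
      using that s1 by (simp add: I_def agree_off_def s2_def)
    show "I 0 (nupd ''r'' 0 0 s2)"
      using s1(1) by (simp add: I_def agree_off_def s2_def)
    fix k s' assume k: "k < R" and s': "I k s'" "nats s' ''r'' 0 = k"
    have "reals s' ''z'' 0 = cheb \<zeta> \<kappa>" "reals s' ''F'' k = phi j k" "nats s' ''j'' 0 = j"
      "reals s' ''S'' k = reals s ''S'' k"
      using s'(1) z s1(1) s1(3)[OF k] eqs by (simp_all add: I_def agree_off_def s2_def)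
    then show "runs_within (RSet ''out'' (V ''j'')
           (RSub (RGet ''out'' (V ''j''))
             (RDiv (RMul (RGet ''F'' (V ''r'')) (RGet ''S'' (V ''r''))) (W ''z'')))) s' 17
        (\<lambda>s'. nats s' ''r'' 0 = k \<and> I (Suc k) (nupd ''r'' 0 (Suc k) s'))"
      using k s' by (intro runs_within_RSet) (simp_all add: I_def agree_off_def diff_diff_eq)
  qed simp
  have w: "rval (W ''w'') s1 = reals s ''w'' 0" "nval (V ''j'') s1 = j"
    using s1(1) eqs by (simp_all add: agree_off_def)
  show "runs_within (Seq (RSet ''out'' (V ''j'') (W ''w''))
   (Seq (For ''r'' (V ''R'') (RSet ''out'' (V ''j'')
           (RSub (RGet ''out'' (V ''j''))
             (RDiv (RMul (RGet ''F'' (V ''r'')) (RGet ''S'' (V ''r''))) (W ''z'')))))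
        (NSet ''q'' (NConst 0) (NAdd (V ''q'') (V ''d''))))) s1 (8 + ((R * 29 + 9) + 7))
    (\<lambda>s'. frame s' \<and>
    nats s' ''j'' 0 = j \<and> nats s' ''q'' 0 = Suc j * d \<and>
    reals s' ''w'' = reals s ''w'' \<and> reals s' ''S'' = reals s ''S'' \<and>
    reals s' ''out'' = (reals s ''out'')(j :=
      reals s ''w'' 0 - (\<Sum>r<R. phi j r * reals s ''S'' r / cheb \<zeta> \<kappa>)))"
  proof (rule runs_within_RSet_Seq[where T' = "(R * 29 + 9) + 7"], unfold w s2_def[symmetric],
      rule runs_within_Seq[OF loop])
    fix s' assume s': "I R s'"
    then have d': "nats s' ''d'' 0 = d"
      using frameD(2)[OF frame1] by (simp add: I_def agree_off_def s2_def)
    have "frame (nupd ''q'' 0 (j * d + d) s')"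
      using s' frame1 by (simp add: I_def frame_def agree_off_def s2_def)
    then show "runs_within (NSet ''q'' (NConst 0) (NAdd (V ''q'') (V ''d''))) s' 7
     (\<lambda>s'. frame s' \<and>
      nats s' ''j'' 0 = j \<and> nats s' ''q'' 0 = Suc j * d \<and>
      reals s' ''w'' = reals s ''w'' \<and> reals s' ''S'' = reals s ''S'' \<and>
      reals s' ''out'' = (reals s ''out'')(j :=
        reals s ''w'' 0 - (\<Sum>r<R. phi j r * reals s ''S'' r / cheb \<zeta> \<kappa>)))"
      using s' d' eqs s1(1) by (intro runs_within_NSet) (simp_all add: I_def agree_off_def s2_def)
  qed simp_all
next
  have "R * 1 \<le> R * R" "1 * 1 \<le> R * R"
    using R_pos by (intro mult_mono; simp)+
  then show "R * R * 240 + (8 + ((R * 29 + 9) + 7)) \<le> 300 * (R * R)"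
    by linarith
qed (use s frameD[OF s(1)] d \<zeta> less_\<kappa> \<kappa> in \<open>simp_all add: R_def N_def gap_def\<close>)

text \<open>The state after \<open>t\<close> complete rounds and the first \<open>j\<close> columns
  of the next one. Thus \<open>j = n\<close> in one round describes the start of the following
  round.\<close>

definition columns :: "nat \<Rightarrow> nat \<Rightarrow> store \<Rightarrow> bool" where
  "columns t j s \<longleftrightarrow> frame s \<and> nats s ''t'' 0 = t \<and> reals s ''out'' = (\<lambda>_. 0) \<and>
    reals s ''w'' 0 = real t * (\<Sum>j<n. y $ j) + (\<Sum>j'<j. y $ j') \<and>
    (\<forall>r<R. reals s ''S'' r = (\<Sum>t'<t. \<Sum>j<n. y $ j * psi t' j r) + (\<Sum>j'<j. y $ j' * psi t j' r))"

lemma runs_within_round: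
  assumes "columns t 0 s"
  shows "runs_within (Seq (NSet ''q'' (NConst 0) (NConst 0)) (For ''j'' (V ''n'') Column)) s
    (n * (300 * (R * R) + 12) + 12) (columns t n)"
proof (rule runs_within_NSet_Seq, rule runs_within_For[where
      I = "\<lambda>j s. columns t j s \<and> nats s ''q'' 0 = j * d" and T = "300 * (R * R)", THEN runs_within_mono])
  fix j s assume j: "j < n" and s: "columns t j s \<and> nats s ''q'' 0 = j * d" "nats s ''j'' 0 = j"
  show "runs_within Column s (300 * (R * R)) (\<lambda>s'. nats s' ''j'' 0 = j \<and>
    columns t (Suc j) (nupd ''j'' 0 (Suc j) s') \<and> nats (nupd ''j'' 0 (Suc j) s') ''q'' 0 = Suc j * d)"
    by (rule runs_within_mono[OF runs_within_Column[where t = t and j = j]])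
      (use s j in \<open>auto simp: columns_def frame_def agree_off_def algebra_simps\<close>)
next
  show "nval (V ''n'') s = n" if "columns t k s \<and> nats s ''q'' 0 = k * d" for k s
    using that by (simp add: columns_def frameD)
qed (use assms in \<open>auto simp: columns_def frame_def agree_off_def algebra_simps\<close>)

lemma columns_next: "columns t n s \<Longrightarrow> columns (Suc t) 0 (nupd ''t'' 0 (Suc t) s)"
  by (auto simp: columns_def frame_def agree_off_def algebra_simps)

lemma runs_within_Query:
  "runs_within Query (query_input M d \<epsilon> xs y) (800 * (M * n * (R * R))) (\<lambda>s. \<forall>i<n. reals s ''out'' i =
    real M * (\<Sum>j<n. y $ j) -
      (\<Sum>r<R. phi i r * (\<Sum>t<M. \<Sum>j<n. y $ j * psi t j r) / cheb \<zeta> \<kappa>))"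
proof -
  let ?o = "\<lambda>i. real M * (\<Sum>j<n. y $ j) -
      (\<Sum>r<R. phi i r * (\<Sum>t<M. \<Sum>j<n. y $ j * psi t j r) / cheb \<zeta> \<kappa>)"
  define T1 where "T1 = n * (300 * (R * R) + 12) + 12"
  have first: "runs_within (For ''t'' (V ''M'') (Seq (NSet ''q'' (NConst 0) (NConst 0)) (For ''j'' (V ''n'') Column)))
    (query_input M d \<epsilon> xs y) (M * (T1 + 12) + 9) (columns M 0)"
  proof (rule runs_within_For[where T = T1 and I = "\<lambda>t. columns t 0"])
    fix t s assume "columns t 0 s"
    from runs_within_round[OF this]
    show "runs_within (Seq (NSet ''q'' (NConst 0) (NConst 0)) (For ''j'' (V ''n'') Column)) s T1
      (\<lambda>s'. nats s' ''t'' 0 = t \<and> columns (Suc t) 0 (nupd ''t'' 0 (Suc t) s'))"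
      unfolding T1_def
      by (rule runs_within_mono) (simp_all add: columns_next, simp add: columns_def)
    show "nval (V ''M'') s = M"
      using \<open>columns t 0 s\<close> by (simp add: columns_def frameD)
  next
    show "columns 0 0 (nupd ''t'' 0 0 (query_input M d \<epsilon> xs y))"
      by (simp add: columns_def frame_def agree_off_def query_input_def)
  qed simp
  define J where "J j s \<longleftrightarrow> frame s \<and> nats s ''q'' 0 = j * d \<and>
    reals s ''w'' 0 = real M * (\<Sum>j<n. y $ j) \<and>
    (\<forall>r<R. reals s ''S'' r = (\<Sum>t<M. \<Sum>j<n. y $ j * psi t j r)) \<and>
    (\<forall>i<j. reals s ''out'' i = ?o i)" for j s
  have second: "runs_within (For ''j'' (V ''n'') Row) s (n * (300 * (R * R) + 12) + 9) (J n)"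
    if "J 0 s" for s
  proof (rule runs_within_For[where T = "300 * (R * R)" and I = J])
    fix j s assume j: "j < n" and s: "J j s" "nats s ''j'' 0 = j"
    show "runs_within Row s (300 * (R * R)) (\<lambda>s'. nats s' ''j'' 0 = j \<and> J (Suc j) (nupd ''j'' 0 (Suc j) s'))"
    proof (rule runs_within_mono[OF runs_within_Row[where j = j] order_refl])
      fix s' assume s': "frame s' \<and>
        nats s' ''j'' 0 = j \<and> nats s' ''q'' 0 = Suc j * d \<and>
        reals s' ''w'' = reals s ''w'' \<and> reals s' ''S'' = reals s ''S'' \<and>
        reals s' ''out'' = (reals s ''out'')(j :=
          reals s ''w'' 0 - (\<Sum>r<R. phi j r * reals s ''S'' r / cheb \<zeta> \<kappa>))"
      have "frame (nupd ''j'' 0 (Suc j) s')"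
        using s' by (simp add: frame_def agree_off_def)
      moreover have "reals s' ''out'' i = ?o i" if "i < Suc j" for i
        using s s' that by (cases "i = j") (simp_all add: J_def)
      ultimately show "nats s' ''j'' 0 = j \<and> J (Suc j) (nupd ''j'' 0 (Suc j) s')"
        using s s' by (simp add: J_def)
    qed (use s j in \<open>simp_all add: J_def\<close>)
  next
    show "nval (V ''n'') s = n" if "J k s" for k s
      using that by (simp add: J_def frameD)
    show "J 0 (nupd ''j'' 0 0 s)"
      using that by (simp add: J_def frame_def agree_off_def)
  qed simp
  have "runs_within Query (query_input M d \<epsilon> xs y)
      ((M * (T1 + 12) + 9) + (3 + (n * (300 * (R * R) + 12) + 9))) (J n)"
    unfolding Query_def
  proof (rule runs_within_Seq[OF first])
    fix s assume s: "columns M 0 s"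
    have "J 0 (nupd ''q'' 0 0 s)"
      using s by (simp add: J_def columns_def frame_def agree_off_def)
    from second[OF this]
    show "runs_within (Seq (NSet ''q'' (NConst 0) (NConst 0)) (For ''j'' (V ''n'') Row)) s
      (3 + (n * (300 * (R * R) + 12) + 9)) (J n)"
      by (intro runs_within_NSet_Seq[where T' = "n * (300 * (R * R) + 12) + 9"]) simp_all
  qed simp
  then show ?thesis
  proof (rule runs_within_mono)
    \<comment> \<open>A round with its loop overhead costs at most \<open>336 * Z\<close>, and so
      does the pass over the rows up to small terms; \<open>M \<ge> 1\<close> merges the two into
      \<open>800 * (M * Z)\<close>.\<close>
    define Z where "Z = n * (R * R)"
    have "1 * (1 * 1) \<le> Z" "n * (1 * 1) \<le> Z"
      unfolding Z_def using R_pos n by (intro mult_mono; simp)+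
    then have Z: "1 \<le> Z" "n \<le> Z" by simp_all
    have T1: "T1 = 300 * Z + 12 * n + 12" and n12: "n * (300 * (R * R) + 12) = 300 * Z + 12 * n"
      by (simp_all add: T1_def Z_def algebra_simps)
    have "M * (T1 + 12) \<le> M * (336 * Z)"
      by (rule mult_left_mono) (use Z T1 in linarith, simp)
    moreover have "1 * Z \<le> M * Z"
      using M by (intro mult_right_mono) simp_all
    ultimately have "(M * (T1 + 12) + 9) + (3 + (n * (300 * (R * R) + 12) + 9)) \<le> 800 * (M * Z)"
      unfolding n12 using Z by linarith
    then show "(M * (T1 + 12) + 9) + (3 + (n * (300 * (R * R) + 12) + 9)) \<le> 800 * (M * n * (R * R))"
      by (simp add: Z_def mult.assoc)
  qed (simp add: J_def)
qed

section \<open>The computed matrix and its distance from the true one\<close>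

definition cnt :: "nat \<Rightarrow> nat \<Rightarrow> nat \<Rightarrow> nat" where
  "cnt t i j = card {k. k < d \<and> t < dst j k (xs ! i $ k)}"

text \<open>The definition involves the points but not the query \<open>y\<close>, so a single
  matrix serves all queries.\<close>

definition approx :: "real mat" where
  "approx = mat n n (\<lambda>(i, j). \<Sum>t<M. 1 - cheb (\<zeta> - real (cnt t i j) / real d) \<kappa> / cheb \<zeta> \<kappa>)"

text \<open>For each coordinate, \<open>same\<close> selects the one value \<open>b\<close> that
  point \<open>i\<close> has there; it lies in the range of summation because coordinates are at
  most \<open>M\<close>. What remains is the count of coordinates with gap above \<open>t\<close>,
  divided by \<open>- d\<close>.\<close>

lemma sum_phi_mult_psi:
  assumes "i < n" and grid: "\<And>k. k < d \<Longrightarrow> xs ! i $ k \<le> M"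
  shows "(\<Sum>r<R. phi i r * psi t j r) = cheb (\<zeta> - real (cnt t i j) / real d) \<kappa>"
proof -
  have "(\<Sum>r<N. same i (r div (M + 1)) (r mod (M + 1)) * far t j (r div (M + 1)) (r mod (M + 1))) =
      (\<Sum>a<d. \<Sum>b<M + 1. same i a b * far t j a b)"
    unfolding N_def by (rule sum_div_mod)
  also have "\<dots> = (\<Sum>a<d. far t j a (xs ! i $ a))"
  proof (rule sum.cong)
    fix a assume a: "a \<in> {..<d}"
    have "(\<Sum>b<M + 1. same i a b * far t j a b) =
        (\<Sum>b<M + 1. if b = xs ! i $ a then far t j a b else 0)"
      by (rule sum.cong) (auto simp: same_def dst_def)
    also have "\<dots> = far t j a (xs ! i $ a)"
      using grid[of a] a by (simp add: sum.delta less_Suc_eq_le)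
    finally show "(\<Sum>b<M + 1. same i a b * far t j a b) = far t j a (xs ! i $ a)" .
  qed simp
  also have "\<dots> = (\<Sum>a<d. - ((if t < dst j a (xs ! i $ a) then 1 else 0) / real d))"
    by (rule sum.cong) (auto simp: far_def)
  also have "\<dots> = - ((\<Sum>a<d. if t < dst j a (xs ! i $ a) then 1 else 0) / real d)"
    by (simp add: sum_negf sum_divide_distrib)
  also have "(\<Sum>a<d. if t < dst j a (xs ! i $ a) then 1 else 0) = real (cnt t i j)"
    by (simp add: cnt_def sum.If_cases Int_def lessThan_def)
  finally show ?thesis
    unfolding R_def phi_def psi_def sum_feat_mult_feat by simp
qed

text \<open>Exchanging the sums brings the one over \<open>r\<close> inside, where it is the inner
  product just evaluated.\<close>

lemma approx_mult_vec:
  assumes "i < n" and "\<And>k. k < d \<Longrightarrow> xs ! i $ k \<le> M"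
  shows "real M * (\<Sum>j<n. y $ j) -
      (\<Sum>r<R. phi i r * (\<Sum>t<M. \<Sum>j<n. y $ j * psi t j r) / cheb \<zeta> \<kappa>) = (approx *\<^sub>v y) $ i"
proof -
  have "(\<Sum>r<R. phi i r * (\<Sum>t<M. \<Sum>j<n. y $ j * psi t j r) / cheb \<zeta> \<kappa>) =
      (\<Sum>r<R. \<Sum>t<M. \<Sum>j<n. phi i r * (y $ j * psi t j r) / cheb \<zeta> \<kappa>)"
    by (simp only: sum_distrib_left sum_divide_distrib)
  also have "\<dots> = (\<Sum>t<M. \<Sum>r<R. \<Sum>j<n. phi i r * (y $ j * psi t j r) / cheb \<zeta> \<kappa>)"
    by (rule sum.swap)
  also have "\<dots> = (\<Sum>t<M. \<Sum>j<n. \<Sum>r<R. phi i r * (y $ j * psi t j r) / cheb \<zeta> \<kappa>)"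
    by (rule sum.cong[OF refl sum.swap])
  also have "\<dots> = (\<Sum>t<M. \<Sum>j<n. y $ j * ((\<Sum>r<R. phi i r * psi t j r) / cheb \<zeta> \<kappa>))"
    by (simp only: sum_distrib_left sum_divide_distrib) (simp add: mult_ac)
  finally have "real M * (\<Sum>j<n. y $ j) -
      (\<Sum>r<R. phi i r * (\<Sum>t<M. \<Sum>j<n. y $ j * psi t j r) / cheb \<zeta> \<kappa>) =
    (\<Sum>t<M. \<Sum>j<n. y $ j * (1 - cheb (\<zeta> - real (cnt t i j) / real d) \<kappa> / cheb \<zeta> \<kappa>))"
    by (simp add: sum_phi_mult_psi assms right_diff_distrib sum_subtractf)
  also have "\<dots> = (\<Sum>j<n. \<Sum>t<M. y $ j * (1 - cheb (\<zeta> - real (cnt t i j) / real d) \<kappa> / cheb \<zeta> \<kappa>))"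
    by (rule sum.swap)
  also have "\<dots> = (approx *\<^sub>v y) $ i"
    using assms(1) y
    by (simp add: approx_def scalar_prod_def sum_distrib_left atLeast0LessThan mult.commute)
  finally show ?thesis .
qed

text \<open>The norm is a natural number \<open>D \<le> M\<close>, hence the number of
  \<open>t < M\<close> with \<open>t < D\<close>. The latter means that some coordinate differs by
  more than \<open>t\<close>.\<close>

lemma vec_max_norm_diff:
  assumes dim: "dim_vec (xs ! i) = d" "dim_vec (xs ! j) = d" and grid: "\<And>k. k < d \<Longrightarrow> xs ! i $ k \<le> M"
    "\<And>k. k < d \<Longrightarrow> xs ! j $ k \<le> M"
  shows "vec_max_norm (map_vec real (xs ! i) - map_vec real (xs ! j)) =
    (\<Sum>t<M. if cnt t i j = 0 then 0 else 1)"
proof -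
  define D where "D = Max ((\<lambda>k. dst j k (xs ! i $ k)) ` {..<d})"
  have ne: "(\<lambda>k. dst j k (xs ! i $ k)) ` {..<d} \<noteq> {}" "finite ((\<lambda>k. dst j k (xs ! i $ k)) ` {..<d})"
    using d by (auto simp: lessThan_empty_iff)
  have less_D: "t < D \<longleftrightarrow> cnt t i j \<noteq> 0" for t
    unfolding D_def Max_gr_iff[OF ne(2,1)] cnt_def by auto
  have "dst j k (xs ! i $ k) \<le> M" if "k < d" for k
    using grid[OF that] unfolding dst_def by linarith
  then have "D \<le> M"
    unfolding D_def Max_le_iff[OF ne(2,1)] by auto
  define w where "w = map_vec real (xs ! i) - map_vec real (xs ! j)"
  have w: "dim_vec w = d" "k < d \<Longrightarrow> \<bar>w $ k\<bar> = real (dst j k (xs ! i $ k))" for k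
    using dim by (simp_all add: w_def dst_def)
  have "{\<bar>w $ k\<bar> | k. k < d} = (\<lambda>k. \<bar>w $ k\<bar>) ` {..<d}"
    by auto
  also have "\<dots> = real ` (\<lambda>k. dst j k (xs ! i $ k)) ` {..<d}"
    using w(2) by (simp add: image_image)
  finally have "{\<bar>w $ k\<bar> | k. k < dim_vec w} = real ` (\<lambda>k. dst j k (xs ! i $ k)) ` {..<d}"
    by (simp only: w(1))
  then have "vec_max_norm w = real D"
    unfolding vec_max_norm_def D_def
    using mono_Max_commute[of real, OF _ ne(2,1)] by (simp add: mono_def)
  also have "\<dots> = (\<Sum>t<M. if t < D then 1 else 0)"
  proof -
    have "{t. t < M \<and> t < D} = {..<D}" using \<open>D \<le> M\<close> by auto
    then show ?thesis by (simp add: sum.If_cases Int_def lessThan_def)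
  qed
  also have "\<dots> = (\<Sum>t<M. if cnt t i j = 0 then 0 else 1)"
    by (rule sum.cong) (simp_all add: less_D)
  finally show ?thesis
    by (simp only: w_def)
qed

text \<open>At \<open>c = 0\<close> the quotient is 1 and the error vanishes. For
  \<open>c \<ge> 1\<close> and \<open>d \<ge> 2\<close> the argument lies in [-1, 1], so the error
  is at most \<open>1 / cheb \<zeta> \<kappa>\<close>, which the stopping test bounds by
  \<open>\<epsilon> / M\<close>.\<close>

lemma term_error:
  assumes "0 < \<epsilon>" and c: "c \<le> d"
  shows "real M * \<bar>(if c = 0 then 0 else 1) - (1 - cheb (\<zeta> - real c / real d) \<kappa> / cheb \<zeta> \<kappa>)\<bar> \<le> \<epsilon>"
proof (cases "d = 1")
  case True
  then have "\<zeta> = 1" by (simp add: \<zeta>)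
  \<comment> \<open>A positive \<open>\<kappa>\<close> would require the test
    \<open>\<epsilon> < 0\<close> to succeed. With degree 1 and \<open>\<zeta> = 1\<close> the term
    is exactly \<open>c\<close>.\<close>
  have "\<kappa> = 0"
    using less_\<kappa>[of 0] True assms by (cases \<kappa>) (auto simp: \<open>\<zeta> = 1\<close>)
  then show ?thesis
    using True assms \<open>\<zeta> = 1\<close> by (cases "c = 0") (auto simp: le_Suc_eq)
next
  case False
  then have d2: "1 - (2 - d) = 1" using d by simp
  have \<zeta>1: "\<zeta> = 1 + 1 / real d"
    by (simp only: \<zeta> d2 of_nat_1)
  have ge1: "1 \<le> cheb \<zeta> \<kappa>"
    using cheb_mono[of \<zeta> \<zeta> \<kappa>] by (simp add: \<zeta>1)
  have M\<epsilon>: "real M / cheb \<zeta> \<kappa> \<le> \<epsilon>"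
  proof -
    have "real M \<le> cheb \<zeta> \<kappa> * \<epsilon>"
      using \<kappa> by (simp only: d2 of_nat_1 mult_1_right not_less)
    then show ?thesis
      using ge1 by (simp add: pos_divide_le_eq mult.commute)
  qed
  show ?thesis
  proof (cases "c = 0")
    case True
    then show ?thesis using ge1 assms by simp
  next
    case c0: False
    have "real c / real d \<le> 1" "1 / real d \<le> real c / real d"
      using c0 c d by (auto intro: divide_right_mono)
    then have "\<bar>\<zeta> - real c / real d\<bar> \<le> 1"
      unfolding \<zeta>1 using divide_nonneg_nonneg[of 1 "real d"] by (simp only: abs_le_iff) linarith
    then have "real M * (\<bar>cheb (\<zeta> - real c / real d) \<kappa>\<bar> / cheb \<zeta> \<kappa>) \<le> real M * (1 / cheb \<zeta> \<kappa>)"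
      using ge1 by (intro mult_left_mono divide_right_mono abs_cheb_le_1) auto
    then show ?thesis
      using c0 ge1 M\<epsilon> by simp
  qed
qed

lemma mat_max_norm_error:
  assumes "0 < \<epsilon>" and grid: "set xs \<subseteq> grid M d"
  shows "mat_max_norm (linf_dist_matrix xs - approx) \<le> \<epsilon>"
proof -
  have entry: "\<bar>(linf_dist_matrix xs - approx) $$ (i, j)\<bar> \<le> \<epsilon>" if ij: "i < n" "j < n" for i j
  proof -
    have "xs ! i \<in> grid M d" "xs ! j \<in> grid M d"
      using grid ij len by (auto simp: subset_iff)
    then have dist: "vec_max_norm (map_vec real (xs ! i) - map_vec real (xs ! j)) =
        (\<Sum>t<M. if cnt t i j = 0 then 0 else 1)"
      by (intro vec_max_norm_diff) (auto simp: grid_def)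
    have "(linf_dist_matrix xs - approx) $$ (i, j) =
        (\<Sum>t<M. (if cnt t i j = 0 then 0 else 1) -
          (1 - cheb (\<zeta> - real (cnt t i j) / real d) \<kappa> / cheb \<zeta> \<kappa>))"
      using ij by (simp only: sum_subtractf dist[symmetric]) (simp add: linf_dist_matrix_def approx_def len sum_subtractf)
    also have "\<bar>\<dots>\<bar> \<le> (\<Sum>t<M. \<epsilon> / real M)"
    proof (rule order_trans[OF sum_abs sum_mono])
      fix t
      have "cnt t i j \<le> card {..<d}"
        unfolding cnt_def by (rule card_mono) auto
      then show "\<bar>(if cnt t i j = 0 then 0 else 1) -
          (1 - cheb (\<zeta> - real (cnt t i j) / real d) \<kappa> / cheb \<zeta> \<kappa>)\<bar> \<le> \<epsilon> / real M"
        using term_error[OF assms(1), of "cnt t i j"] M by (simp add: field_simps)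
    qed
    also have "\<dots> = \<epsilon>" using M by simp
    finally show ?thesis .
  qed
  let ?S = "{\<bar>(linf_dist_matrix xs - approx) $$ (i, j)\<bar> | i j. i < n \<and> j < n}"
  have "?S = (\<lambda>(i, j). \<bar>(linf_dist_matrix xs - approx) $$ (i, j)\<bar>) ` ({..<n} \<times> {..<n})"
    by auto
  then have "finite ?S" "?S \<noteq> {}"
    using n by (auto simp: lessThan_empty_iff)
  then have "Max ?S \<le> \<epsilon>"
    using entry by (subst Max_le_iff) auto
  then show ?thesis
    by (simp add: mat_max_norm_def approx_def)
qed

lemma outputs_approx:
  assumes "set xs \<subseteq> grid M d" and "800 * real (M * n * (R * R)) \<le> T"
  shows "outputs_in_time Query (query_input M d \<epsilon> xs y) (approx *\<^sub>v y) T"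
proof -
  obtain t s where ts: "exec Query (query_input M d \<epsilon> xs y) t s" "t \<le> 800 * (M * n * (R * R))"
    "\<And>i. i < n \<Longrightarrow> reals s ''out'' i = real M * (\<Sum>j<n. y $ j) -
      (\<Sum>r<R. phi i r * (\<Sum>t<M. \<Sum>j<n. y $ j * psi t j r) / cheb \<zeta> \<kappa>)"
    using runs_within_Query unfolding runs_within_def by blast
  have "real t \<le> T"
    using ts(2) assms(2) by (metis of_nat_le_iff of_nat_mult of_nat_numeral order_trans)
  moreover have "reals s ''out'' i = (approx *\<^sub>v y) $ i" if "i < n" for i
  proof -
    have "xs ! i \<in> grid M d" using assms(1) that len by (auto simp: subset_iff)
    then show ?thesis
      using ts(3)[OF that] approx_mult_vec[OF that] by (simp add: grid_def)
  qed
  ultimately show ?thesis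
    unfolding outputs_in_time_def using ts(1) by (intro exI[of _ t] exI[of _ s]) (simp add: approx_def)
qed

end

section \<open>Choice of the degree and of the constants\<close>

theorem theorem11:
  shows "\<exists>(P :: com) (K :: real) (C :: real). \<forall>(M :: nat) (d :: nat) (n :: nat) (\<epsilon> :: real) (xs :: nat vec list).
    1 \<le> M \<and> 1 \<le> d \<and> 1 \<le> n \<and> 0 < \<epsilon> \<and> \<epsilon> < 1 \<and> length xs = n \<and> set xs \<subseteq> grid M d \<longrightarrow>
    (\<exists>B \<in> carrier_mat n n.
       mat_max_norm (linf_dist_matrix xs - B) \<le> \<epsilon> \<and>
       (\<forall>y \<in> carrier_vec n.
          outputs_in_time P (query_input M d \<epsilon> xs y) (B *\<^sub>v y)
            (K * (real n * (real d * real M) powr (C * (real M * sqrt (real d) * ln (real M * real d / \<epsilon>))))))) "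
proof (rule exI[of _ Query], rule exI[of _ 7200], rule exI[of _ 26], intro allI impI, elim conjE)
  fix M d n :: nat and \<epsilon> :: real and xs :: "nat vec list"
  assume A: "1 \<le> M" "1 \<le> d" "1 \<le> n" "0 < \<epsilon>" "\<epsilon> < 1" "length xs = n" and grid: "set xs \<subseteq> grid M d"
  define \<zeta> where "\<zeta> = 1 + real (1 - (2 - d)) / real d"
  define \<kappa> where "\<kappa> = (LEAST k. \<not> cheb \<zeta> k * \<epsilon> < real M * real (1 - (2 - d)))"
  have \<kappa>: "\<not> cheb \<zeta> \<kappa> * \<epsilon> < real M * real (1 - (2 - d))"
    unfolding \<kappa>_def by (rule LeastI_ex[OF cheb_stops]) (use A \<zeta>_def in auto)
  have less_\<kappa>: "cheb \<zeta> k * \<epsilon> < real M * real (1 - (2 - d))" if "k < \<kappa>" for k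
    using not_less_Least[OF that[unfolded \<kappa>_def]] by simp
  have run: "query_run M d n \<kappa> \<epsilon> \<zeta> xs y" if "y \<in> carrier_vec n" for y
    by unfold_locales (use A that \<zeta>_def \<kappa> less_\<kappa> in auto)
  have \<kappa>_bound: "\<kappa> = 0 \<or> 2 \<le> d \<and> 2 ^ \<kappa> \<le> 2 * (sqrt (real d) * ln (2 * real M / \<epsilon>))"
  proof (cases \<kappa>)
    case (Suc k)
    then have k: "cheb \<zeta> k * \<epsilon> < real M * real (1 - (2 - d))" by (intro less_\<kappa>) simp
    have d: "2 \<le> d"
    proof (rule ccontr)
      assume "\<not> 2 \<le> d"
      then have "d = 1" using A by simp
      then show False using k A by (simp add: \<zeta>_def)
    qed
    then have d': "1 - (2 - d) = 1" by simp
    have "cheb (1 + 1 / real d) k * \<epsilon> < real M"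
      using k by (simp only: \<zeta>_def d' of_nat_1 mult_1_right)
    \<comment> \<open>The test still succeeded at \<open>\<kappa> - 1\<close>; the last step doubles
      the degree, whence the factor 2.\<close>
    from power_less_of_cheb_less[OF A(2,4) this] d Suc show ?thesis by simp
  qed simp
  \<comment> \<open>The locale fixes a query vector. An arbitrary one gives access to
    \<open>approx\<close> and \<open>R\<close>, which are the same for every query.\<close>
  obtain y0 :: "real vec" where y0: "y0 \<in> carrier_vec n"
    using zero_carrier_vec by blast
  interpret y0: query_run M d n \<kappa> \<epsilon> \<zeta> xs y0 by (rule run[OF y0])
  define T where "T = (real d * real M) powr (26 * (real M * sqrt (real d) * ln (real M * real d / \<epsilon>)))"
  have "real (M * (y0.R * y0.R)) \<le> 9 * T"
    unfolding y0.R_def y0.N_def T_def by (rule fsize_time_bound) (use A \<kappa>_bound in auto)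
  \<comment> \<open>The constant 7200 is the 800 of \<open>runs_within_Query\<close> times the 9 of
    \<open>fsize_time_bound\<close>.\<close>
  then have "800 * real n * real (M * (y0.R * y0.R)) \<le> 800 * real n * (9 * T)"
    by (rule mult_left_mono) simp
  then have time: "800 * real (M * n * (y0.R * y0.R)) \<le> 7200 * (real n * T)"
    by (simp add: mult_ac)
  show "\<exists>B \<in> carrier_mat n n. mat_max_norm (linf_dist_matrix xs - B) \<le> \<epsilon> \<and>
       (\<forall>y \<in> carrier_vec n. outputs_in_time Query (query_input M d \<epsilon> xs y) (B *\<^sub>v y)
          (7200 * (real n * (real d * real M) powr (26 * (real M * sqrt (real d) * ln (real M * real d / \<epsilon>))))))"
  proof (intro bexI conjI ballI)
    show "mat_max_norm (linf_dist_matrix xs - y0.approx) \<le> \<epsilon>"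
      by (rule y0.mat_max_norm_error[OF A(4) grid])
    show "y0.approx \<in> carrier_mat n n"
      by (simp add: y0.approx_def)
    fix y :: "real vec" assume y: "y \<in> carrier_vec n"
    interpret y: query_run M d n \<kappa> \<epsilon> \<zeta> xs y by (rule run[OF y])
    show "outputs_in_time Query (query_input M d \<epsilon> xs y) (y0.approx *\<^sub>v y)
          (7200 * (real n * (real d * real M) powr (26 * (real M * sqrt (real d) * ln (real M * real d / \<epsilon>)))))"
      unfolding T_def[symmetric] by (rule y.outputs_approx[OF grid time])
  qed
qed

end
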